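(* The space $R=\bigoplus_{n\ge0}H^0(\mathcal{L}_{-n},\overline{\nabla})$ carries a ring structure, induced by the multiplication isomorphisms $\mathcal{L}_{-n}\otimes_{\mathcal{A}(\mathbb{CP}^1_q)}\mathcal{L}_{-m}\simeq\mathcal{L}_{-n-m}$ (i.e. by the product of $\mathcal{A}(SU_q(2))$), and as a ring $R$ is isomorphic to the coordinate ring of the quantum plane $\mathbb{C}\langle a,c\rangle/(ac-qca)$.
   Context: Fix $0<q<1$. Let $\mathcal{A}(SU_q(2))$ be the unital complex $*$-algebra generated by $a,c$ subject to $ac=qca$, $ac^*=qc^*a$, $cc^*=c^*c$, $a^*a+c^*c=aa^*+q^2cc^*=1$. Let $U_q(su(2))$ be the Hopf algebra generated by $K,K^{-1},E,F$ with $KK^{-1}=K^{-1}K=1$, $KE=qEK$, $KF=q^{-1}FK$, $EF-FE=(K^2-K^{-2})/(q-q^{-1})$, coproduct $\Delta K=K\otimes K$, $\Delta E=E\otimes K+K^{-1}\otimes E$, $\Delta F=F\otimes K+K^{-1}\otimes F$, counit $\epsilon(K)=1,\epsilon(E)=\epsilon(F)=0$. It acts on $\mathcal{A}(SU_q(2))$ from the left making it a left module algebra, with $K\triangleright a=q^{-1/2}a$, $K\triangleright c=q^{-1/2}c$, $K\triangleright a^*=q^{1/2}a^*$, $K\triangleright c^*=q^{1/2}c^*$, $E\triangleright a=-qc^*$, $E\triangleright c=a^*$, $E\triangleright a^*=E\triangleright c^*=0$, $F\triangleright a=F\triangleright c=0$, $F\triangleright a^*=c$, $F\triangleright c^*=-q^{-1}a$.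 Put $X_-=q^{-1/2}FK$. For $k\in\mathbb{Z}$ let $\mathcal{L}_k=\{x\in\mathcal{A}(SU_q(2)):K\triangleright x=q^{k/2}x\}$, a bimodule over $\mathcal{A}(\mathbb{CP}^1_q):=\mathcal{L}_0$. Let $\Omega^1(SU_q(2))$ be the $\mathcal{A}(SU_q(2))$-bimodule that is free as a left module with basis $\omega_+,\omega_-,\omega_z$. The standard holomorphic structure on $\mathcal{L}_k$ is $\overline{\nabla}\phi:=(X_-\triangleright\phi)\,\omega_-$, and $H^0(\mathcal{L}_k,\overline{\nabla}):=\{\phi\in\mathcal{L}_k:\overline{\nabla}\phi=0\}$. *)

theory Defs
  imports Complex_Main "HOL-Algebra.QuotRing"
begin

definition fa_mult :: "('g list \<Rightarrow> complex) \<Rightarrow> ('g list \<Rightarrow> complex) \<Rightarrow> 'g list \<Rightarrow> complex" where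
  "fa_mult f g w = (\<Sum>i\<le>length w. f (take i w) * g (drop i w))"

definition freealg :: "('g list \<Rightarrow> complex) ring" where
  "freealg = \<lparr>carrier = {f. finite {w. f w \<noteq> 0}},
              mult = fa_mult,
              one = (\<lambda>w. if w = [] then 1 else 0),
              zero = (\<lambda>w. 0),
              add = (\<lambda>f g w. f w + g w)\<rparr>"

definition fa_gen :: "'g \<Rightarrow> 'g list \<Rightarrow> complex" where
  "fa_gen x = (\<lambda>w. if w = [x] then 1 else 0)"

definition fa_scal :: "complex \<Rightarrow> ('g list \<Rightarrow> complex) \<Rightarrow> 'g list \<Rightarrow> complex" where
  "fa_scal s f = (\<lambda>w. s * f w)"

text \<open>Generators of the *-algebra: a, a*, c, c*.  The relations of the *-algebra
  generated by a, c are the given ones together with their adjoints.\<close>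

datatype sgen = GA | GAs | GC | GCs

definition su_rels :: "real \<Rightarrow> (sgen list \<Rightarrow> complex) set" where
  "su_rels q = (let R = (freealg :: (sgen list \<Rightarrow> complex) ring);
      a = fa_gen GA; as = fa_gen GAs; c = fa_gen GC; cs = fa_gen GCs;
      Q = complex_of_real q in
    { a \<otimes>\<^bsub>R\<^esub> c \<ominus>\<^bsub>R\<^esub> fa_scal Q (c \<otimes>\<^bsub>R\<^esub> a),
      a \<otimes>\<^bsub>R\<^esub> cs \<ominus>\<^bsub>R\<^esub> fa_scal Q (cs \<otimes>\<^bsub>R\<^esub> a),
      cs \<otimes>\<^bsub>R\<^esub> as \<ominus>\<^bsub>R\<^esub> fa_scal Q (as \<otimes>\<^bsub>R\<^esub> cs),
      c \<otimes>\<^bsub>R\<^esub> as \<ominus>\<^bsub>R\<^esub> fa_scal Q (as \<otimes>\<^bsub>R\<^esub> c),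
      c \<otimes>\<^bsub>R\<^esub> cs \<ominus>\<^bsub>R\<^esub> cs \<otimes>\<^bsub>R\<^esub> c,
      (as \<otimes>\<^bsub>R\<^esub> a \<oplus>\<^bsub>R\<^esub> cs \<otimes>\<^bsub>R\<^esub> c) \<ominus>\<^bsub>R\<^esub> \<one>\<^bsub>R\<^esub>,
      (a \<otimes>\<^bsub>R\<^esub> as \<oplus>\<^bsub>R\<^esub> fa_scal (Q^2) (c \<otimes>\<^bsub>R\<^esub> cs)) \<ominus>\<^bsub>R\<^esub> \<one>\<^bsub>R\<^esub> })"

definition su_ideal :: "real \<Rightarrow> (sgen list \<Rightarrow> complex) set" where
  "su_ideal q = genideal freealg (su_rels q)"

definition ASUq :: "real \<Rightarrow> (sgen list \<Rightarrow> complex) set ring" where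
  "ASUq q = freealg Quot su_ideal q"

definition qlift :: "real \<Rightarrow> ((sgen list \<Rightarrow> complex) \<Rightarrow> (sgen list \<Rightarrow> complex))
    \<Rightarrow> (sgen list \<Rightarrow> complex) set \<Rightarrow> (sgen list \<Rightarrow> complex) set" where
  "qlift q T X = su_ideal q +>\<^bsub>freealg\<^esub>
      T (SOME x. x \<in> carrier freealg \<and> X = su_ideal q +>\<^bsub>freealg\<^esub> x)"

text \<open>K acts on generators by scalars: a, c by q^(-1/2), a*, c* by q^(1/2);
  as K is group-like it acts on words multiplicatively.\<close>

definition Kgen :: "real \<Rightarrow> sgen \<Rightarrow> complex" where
  "Kgen q g = (case g of GA \<Rightarrow> complex_of_real (q powr (-1/2))
                       | GC \<Rightarrow> complex_of_real (q powr (-1/2))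
                       | GAs \<Rightarrow> complex_of_real (q powr (1/2))
                       | GCs \<Rightarrow> complex_of_real (q powr (1/2)))"

definition Kword :: "real \<Rightarrow> sgen list \<Rightarrow> complex" where
  "Kword q w = prod_list (map (Kgen q) w)"

definition Kinvword :: "real \<Rightarrow> sgen list \<Rightarrow> complex" where
  "Kinvword q w = prod_list (map (\<lambda>g. inverse (Kgen q g)) w)"

definition Fgen :: "real \<Rightarrow> sgen \<Rightarrow> (complex \<times> sgen) option" where
  "Fgen q g = (case g of GA \<Rightarrow> None | GC \<Rightarrow> None
                       | GAs \<Rightarrow> Some (1, GC)
                       | GCs \<Rightarrow> Some (- inverse (complex_of_real q), GA))"

text \<open>Since Delta F = F (x) K + K^(-1) (x) F, on a word
  F(x1...xn) = sum_i K^(-1)(x1...x_(i-1)) F(x_i) K(x_(i+1)...x_n).\<close>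

definition Fword :: "real \<Rightarrow> sgen list \<Rightarrow> sgen list \<Rightarrow> complex" where
  "Fword q w w' = (\<Sum>i<length w. (case Fgen q (w ! i) of None \<Rightarrow> 0
       | Some (s, g') \<Rightarrow>
           (if w' = take i w @ [g'] @ drop (Suc i) w
            then Kinvword q (take i w) * s * Kword q (drop (Suc i) w) else 0)))"

definition Kfa :: "real \<Rightarrow> (sgen list \<Rightarrow> complex) \<Rightarrow> sgen list \<Rightarrow> complex" where
  "Kfa q f = (\<lambda>w. Kword q w * f w)"

definition Ffa :: "real \<Rightarrow> (sgen list \<Rightarrow> complex) \<Rightarrow> sgen list \<Rightarrow> complex" where
  "Ffa q f = (\<lambda>w'. \<Sum>w\<in>{w. f w \<noteq> 0}. f w * Fword q w w')"

definition Kact :: "real \<Rightarrow> (sgen list \<Rightarrow> complex) set \<Rightarrow> (sgen list \<Rightarrow> complex) set" where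
  "Kact q = qlift q (Kfa q)"

definition Fact :: "real \<Rightarrow> (sgen list \<Rightarrow> complex) set \<Rightarrow> (sgen list \<Rightarrow> complex) set" where
  "Fact q = qlift q (Ffa q)"

definition Sact :: "real \<Rightarrow> complex \<Rightarrow> (sgen list \<Rightarrow> complex) set \<Rightarrow> (sgen list \<Rightarrow> complex) set" where
  "Sact q s = qlift q (fa_scal s)"

definition Xminus :: "real \<Rightarrow> (sgen list \<Rightarrow> complex) set \<Rightarrow> (sgen list \<Rightarrow> complex) set" where
  "Xminus q X = Sact q (complex_of_real (q powr (-1/2))) (Fact q (Kact q X))"

definition LB :: "real \<Rightarrow> int \<Rightarrow> (sgen list \<Rightarrow> complex) set set" where
  "LB q k = {x \<in> carrier (ASUq q).
              Kact q x = Sact q (complex_of_real (q powr (real_of_int k / 2))) x}"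

text \<open>Holomorphic sections: (X_- |> phi) omega_- = 0; since omega_- is part of a
  left basis of the free module Omega^1, this is X_- |> phi = 0.\<close>

definition H0 :: "real \<Rightarrow> int \<Rightarrow> (sgen list \<Rightarrow> complex) set set" where
  "H0 q k = {x \<in> LB q k. Xminus q x = \<zero>\<^bsub>ASUq q\<^esub>}"

definition Rring :: "real \<Rightarrow> (nat \<Rightarrow> (sgen list \<Rightarrow> complex) set) ring" where
  "Rring q = (let A = ASUq q in
     \<lparr>carrier = {\<Phi>. (\<forall>n. \<Phi> n \<in> H0 q (- int n)) \<and> finite {n. \<Phi> n \<noteq> \<zero>\<^bsub>A\<^esub>}},
      mult = (\<lambda>\<Phi> \<Psi> n. finsum A (\<lambda>i. \<Phi> i \<otimes>\<^bsub>A\<^esub> \<Psi> (n - i)) {..n}),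
      one = (\<lambda>n. if n = 0 then \<one>\<^bsub>A\<^esub> else \<zero>\<^bsub>A\<^esub>),
      zero = (\<lambda>n. \<zero>\<^bsub>A\<^esub>),
      add = (\<lambda>\<Phi> \<Psi> n. \<Phi> n \<oplus>\<^bsub>A\<^esub> \<Psi> n)\<rparr>)"

datatype pgen = PA | PC

definition QPlane :: "real \<Rightarrow> (pgen list \<Rightarrow> complex) set ring" where
  "QPlane q = (let R = (freealg :: (pgen list \<Rightarrow> complex) ring) in
     R Quot genideal R {fa_gen PA \<otimes>\<^bsub>R\<^esub> fa_gen PC \<ominus>\<^bsub>R\<^esub>
                        fa_scal (complex_of_real q) (fa_gen PC \<otimes>\<^bsub>R\<^esub> fa_gen PA)})"

end

theory Submission
  imports Defs
begin

text \<open>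
  The monomials a^i c^j c*^k and a*^m c^j c*^k (m > 0) form a basis of the algebra: they span by the
  commutation rules, and left multiplication by the generators can be written down on the free
  vector space over them, which turns it into a module on which the defining relations hold.
  In this basis

    (1 - q^2) X_- (a^i c^j c*^k) = q^(k - j) (1 - q^(-2k)) a^(i + 1) c^j c*^(k - 1),

  while X_- (a*^m c^j c*^k) has an additional term in a*^(m - 1) c^(j + 1) c*^k with nonzero
  coefficient.  Hence the kernel of X_- is the span of the a^i c^j, and the K-weight -n/2 cuts out
  those with i + j = n.  So R is the image of the free algebra on a and c, graded by word length,
  and comparing normal forms shows that the kernel is generated by ac - qca.
\<close>

section \<open>Finitely supported functions and linear extension\<close>

text \<open>\<open>Kact\<close> and \<open>Fact\<close> are evaluated at a \<open>SOME\<close>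
  representative, so they can be computed only once their lifts to the free algebra are known to
  preserve the ideal. This is not checked on the relations. Instead, \<open>nf\<close> is shown to
  have kernel exactly \<open>su_ideal q\<close> and to intertwine \<open>Kfa\<close> with
  \<open>kop\<close> and FK with a multiple of \<open>xop\<close>. Both intertwinings are inductions
  on words that need only the behaviour under left multiplication by one letter, and invariance of
  the ideal follows.

  The coefficients of \<open>rho\<close> come from moving c and c* to the right: a a*^m = a*^(m-1) -
  q^(2m) a*^(m-1) c c* and a* a^i = a^(i-1) - q^(2-2i) a^(i-1) c c*, whereas c and c* pick up q^(-i)
  for either sign of i. In a pull-back, i, j, k name the target monomial, and each relation is a
  pointwise identity between powers of q. The factor 1 - q^2 in \<open>xop\<close> clears the
  denominator of the geometric sum that F produces on c*^k.\<close>

definition finsupp :: "('a \<Rightarrow> complex) \<Rightarrow> bool" where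
  "finsupp f \<longleftrightarrow> finite {x. f x \<noteq> 0}"

lemma finsuppI: "finite S \<Longrightarrow> {x. f x \<noteq> 0} \<subseteq> S \<Longrightarrow> finsupp f"
  unfolding finsupp_def by (rule finite_subset)

definition delta :: "'a \<Rightarrow> 'a \<Rightarrow> complex" where
  "delta x = (\<lambda>y. if y = x then 1 else 0)"

definition linext :: "('a \<Rightarrow> 'b \<Rightarrow> complex) \<Rightarrow> ('a \<Rightarrow> complex) \<Rightarrow> 'b \<Rightarrow> complex" where
  "linext T f = (\<lambda>b. \<Sum>x\<in>{x. f x \<noteq> 0}. f x * T x b)"

text \<open>Linearity is demanded on finitely supported functions only, because
  \<open>linext\<close> sums over the support, and a sum over an infinite set is 0 by
  convention.\<close>

definition linop :: "(('a \<Rightarrow> complex) \<Rightarrow> 'b \<Rightarrow> complex) \<Rightarrow> bool" where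
  "linop T \<longleftrightarrow>
     (\<forall>f g. finsupp f \<longrightarrow> finsupp g \<longrightarrow> T (\<lambda>x. f x + g x) = (\<lambda>y. T f y + T g y)) \<and>
     (\<forall>s f. finsupp f \<longrightarrow> T (\<lambda>x. s * f x) = (\<lambda>y. s * T f y))"

lemma linopI:
  assumes "\<And>f g. finsupp f \<Longrightarrow> finsupp g \<Longrightarrow> T (\<lambda>x. f x + g x) = (\<lambda>y. T f y + T g y)"
    and "\<And>s f. finsupp f \<Longrightarrow> T (\<lambda>x. s * f x) = (\<lambda>y. s * T f y)"
  shows "linop T"
  using assms unfolding linop_def by blast

lemma linop_add:
  "linop T \<Longrightarrow> finsupp f \<Longrightarrow> finsupp g \<Longrightarrow> T (\<lambda>x. f x + g x) = (\<lambda>y. T f y + T g y)"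
  unfolding linop_def by blast

lemma linop_scale: "linop T \<Longrightarrow> finsupp f \<Longrightarrow> T (\<lambda>x. s * f x) = (\<lambda>y. s * T f y)"
  unfolding linop_def by blast

lemma finsupp_zero [simp]: "finsupp (\<lambda>x. 0)"
  by (simp add: finsupp_def)

lemma finsupp_delta [simp]: "finsupp (delta x)"
  by (simp add: finsupp_def delta_def)

lemma finsupp_scale [simp]: "finsupp f \<Longrightarrow> finsupp (\<lambda>x. s * f x)"
  by (rule finsuppI[of "{x. f x \<noteq> 0}"]) (auto simp: finsupp_def)

lemma finsupp_add [simp]: "finsupp f \<Longrightarrow> finsupp g \<Longrightarrow> finsupp (\<lambda>x. f x + g x)"
  by (rule finsuppI[of "{x. f x \<noteq> 0} \<union> {x. g x \<noteq> 0}"]) (auto simp: finsupp_def)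

lemma finsupp_uminus [simp]: "finsupp f \<Longrightarrow> finsupp (\<lambda>x. - f x)"
  by (simp add: finsupp_def)

lemma finsupp_diff [simp]: "finsupp f \<Longrightarrow> finsupp g \<Longrightarrow> finsupp (\<lambda>x. f x - g x)"
  by (rule finsuppI[of "{x. f x \<noteq> 0} \<union> {x. g x \<noteq> 0}"]) (auto simp: finsupp_def)

lemma finsupp_sum:
  "finite S \<Longrightarrow> (\<And>x. x \<in> S \<Longrightarrow> finsupp (V x)) \<Longrightarrow> finsupp (\<lambda>y. \<Sum>x\<in>S. V x y)"
  by (induction S rule: finite_induct) auto

lemma finsupp_fa_scal [simp]: "finsupp f \<Longrightarrow> finsupp (fa_scal s f)"
  unfolding fa_scal_def by (rule finsupp_scale)

lemma linop_zero: "linop T \<Longrightarrow> T (\<lambda>x. 0) = (\<lambda>y. 0)"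
  using linop_scale[of T "\<lambda>x. 0" 0] by simp

lemma linop_diff:
  assumes "linop T" "finsupp f" "finsupp g"
  shows "T (\<lambda>x. f x - g x) = (\<lambda>y. T f y - T g y)"
  using linop_add[OF assms(1,2), of "\<lambda>x. (-1) * g x"] linop_scale[OF assms(1,3), of "-1"] assms
  by (simp only: finsupp_scale) simp

lemma linop_sum:
  assumes "linop T" "finite S" "\<And>x. x \<in> S \<Longrightarrow> finsupp (V x)"
  shows "T (\<lambda>y. \<Sum>x\<in>S. c x * V x y) = (\<lambda>y. \<Sum>x\<in>S. c x * T (V x) y)"
  using assms(2,3)
proof (induction S rule: finite_induct)
  case empty
  then show ?case by (simp add: linop_zero[OF assms(1)])
next
  case (insert x S)
  have "finsupp (\<lambda>y. \<Sum>x\<in>S. c x * V x y)"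
    by (rule finsupp_sum) (use insert in auto)
  then show ?case
    using insert by (simp add: linop_add[OF assms(1)] linop_scale[OF assms(1)])
qed

lemma linext_superset:
  assumes "finite S" "{x. f x \<noteq> 0} \<subseteq> S"
  shows "linext T f = (\<lambda>b. \<Sum>x\<in>S. f x * T x b)"
  unfolding linext_def by (rule ext, rule sum.mono_neutral_left) (use assms in auto)

lemma linext_delta [simp]: "linext T (delta x) = T x"
  by (simp add: linext_superset[of "{x}"] delta_def)

lemma linop_linext [simp]: "linop (linext T)"
proof (rule linopI)
  fix f g :: "'a \<Rightarrow> complex" assume fin: "finsupp f" "finsupp g"
  let ?S = "{x. f x \<noteq> 0} \<union> {x. g x \<noteq> 0}"
  have "linext T (\<lambda>x. f x + g x) = (\<lambda>b. \<Sum>x\<in>?S. (f x + g x) * T x b)"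
    by (rule linext_superset) (use fin in \<open>auto simp: finsupp_def\<close>)
  moreover have "linext T f = (\<lambda>b. \<Sum>x\<in>?S. f x * T x b)"
    by (rule linext_superset) (use fin in \<open>auto simp: finsupp_def\<close>)
  moreover have "linext T g = (\<lambda>b. \<Sum>x\<in>?S. g x * T x b)"
    by (rule linext_superset) (use fin in \<open>auto simp: finsupp_def\<close>)
  ultimately show "linext T (\<lambda>x. f x + g x) = (\<lambda>y. linext T f y + linext T g y)"
    by (simp add: distrib_right sum.distrib)
next
  fix s and f :: "'a \<Rightarrow> complex" assume fin: "finsupp f"
  have "linext T (\<lambda>x. s * f x) = (\<lambda>b. \<Sum>x\<in>{x. f x \<noteq> 0}. (s * f x) * T x b)"
    by (rule linext_superset) (use fin in \<open>auto simp: finsupp_def\<close>)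
  then show "linext T (\<lambda>x. s * f x) = (\<lambda>y. s * linext T f y)"
    by (simp add: linext_def sum_distrib_left mult.assoc)
qed

lemma finsupp_linext:
  "finsupp f \<Longrightarrow> (\<And>x. finsupp (T x)) \<Longrightarrow> finsupp (linext T f)"
  unfolding linext_def by (rule finsupp_sum) (auto simp: finsupp_def)

lemma delta_expansion:
  assumes "finsupp f"
  shows "f = (\<lambda>y. \<Sum>x\<in>{x. f x \<noteq> 0}. f x * delta x y)"
proof
  fix y
  have "(\<Sum>x\<in>{x. f x \<noteq> 0}. f x * delta x y) = (\<Sum>x\<in>{x. f x \<noteq> 0}. if x = y then f y else 0)"
    by (rule sum.cong) (auto simp: delta_def)
  then show "f y = (\<Sum>x\<in>{x. f x \<noteq> 0}. f x * delta x y)"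
    using assms by (simp add: sum.delta' finsupp_def)
qed

lemma linop_expansion:
  assumes "linop T" "finsupp f"
  shows "T f = linext (\<lambda>x. T (delta x)) f"
proof -
  have "T f = T (\<lambda>y. \<Sum>x\<in>{x. f x \<noteq> 0}. f x * delta x y)"
    by (rule arg_cong[OF delta_expansion[OF assms(2)]])
  also have "\<dots> = linext (\<lambda>x. T (delta x)) f"
    unfolding linext_def by (rule linop_sum[OF assms(1)]) (use assms(2) finsupp_delta in \<open>simp_all add: finsupp_def\<close>)
  finally show ?thesis .
qed

lemma linop_eqI:
  assumes "linop T" "linop S" "finsupp f" "\<And>x. T (delta x) = S (delta x)"
  shows "T f = S f"
  by (simp only: linop_expansion[OF assms(1,3)] linop_expansion[OF assms(2,3)] assms(4))

lemma linop_compose: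
  assumes "linop S" "linop T" "\<And>f. finsupp f \<Longrightarrow> finsupp (T f)"
  shows "linop (\<lambda>f. S (T f))"
  by (rule linopI) (use assms in \<open>simp_all add: linop_add linop_scale\<close>)

section \<open>The free algebra\<close>

lemma carrier_freealg [simp]: "f \<in> carrier freealg \<longleftrightarrow> finsupp f"
  and mult_freealg [simp]: "f \<otimes>\<^bsub>freealg\<^esub> g = fa_mult f g"
  and add_freealg [simp]: "f \<oplus>\<^bsub>freealg\<^esub> g = (\<lambda>w. f w + g w)"
  and zero_freealg [simp]: "\<zero>\<^bsub>freealg\<^esub> = (\<lambda>w. 0)"
  and one_freealg [simp]: "\<one>\<^bsub>freealg\<^esub> = delta []"
  by (simp_all add: freealg_def delta_def finsupp_def)

lemma fa_gen_eq: "fa_gen x = delta [x]"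
  by (simp add: fa_gen_def delta_def)

lemma finsupp_fa_mult [simp]:
  assumes "finsupp f" "finsupp g"
  shows "finsupp (fa_mult f g)"
proof (rule finsuppI)
  show "{w. fa_mult f g w \<noteq> 0} \<subseteq> (\<lambda>(u, v). u @ v) ` ({w. f w \<noteq> 0} \<times> {w. g w \<noteq> 0})"
  proof
    fix w assume "w \<in> {w. fa_mult f g w \<noteq> 0}"
    then obtain i where "f (take i w) * g (drop i w) \<noteq> 0"
      unfolding fa_mult_def by (auto elim: sum.not_neutral_contains_not_neutral)
    then show "w \<in> (\<lambda>(u, v). u @ v) ` ({w. f w \<noteq> 0} \<times> {w. g w \<noteq> 0})"
      by (intro image_eqI[of _ _ "(take i w, drop i w)"]) auto
  qed
qed (use assms in \<open>auto simp: finsupp_def\<close>)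

lemma fa_mult_add_left: "fa_mult (\<lambda>w. f w + g w) h = (\<lambda>w. fa_mult f h w + fa_mult g h w)"
  and fa_mult_add_right: "fa_mult h (\<lambda>w. f w + g w) = (\<lambda>w. fa_mult h f w + fa_mult h g w)"
  and fa_mult_diff_left: "fa_mult (\<lambda>w. f w - g w) h = (\<lambda>w. fa_mult f h w - fa_mult g h w)"
  and fa_mult_diff_right: "fa_mult h (\<lambda>w. f w - g w) = (\<lambda>w. fa_mult h f w - fa_mult h g w)"
  and fa_mult_scale_left: "fa_mult (\<lambda>w. s * f w) h = (\<lambda>w. s * fa_mult f h w)"
  and fa_mult_scale_right: "fa_mult h (\<lambda>w. s * f w) = (\<lambda>w. s * fa_mult h f w)"
  by (simp_all add: fa_mult_def fun_eq_iff algebra_simps sum.distrib sum_subtractf sum_distrib_left)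

lemma linop_fa_mult_left [simp]: "linop (\<lambda>f. fa_mult f g)"
  and linop_fa_mult_right [simp]: "linop (fa_mult g)"
  by (rule linopI; simp add: fa_mult_add_left fa_mult_add_right fa_mult_scale_left fa_mult_scale_right)+

lemma fa_mult_delta [simp]: "fa_mult (delta u) (delta v) = delta (u @ v)"
proof
  fix w
  have split: "take i w = u \<and> drop i w = v \<longleftrightarrow> i = length u \<and> w = u @ v" if "i \<le> length w" for i
  proof
    assume "take i w = u \<and> drop i w = v"
    then show "i = length u \<and> w = u @ v"
      using that append_take_drop_id[of i w] length_take[of i w] by (metis min.absorb2)
  qed auto
  have "delta u (take i w) * delta v (drop i w) = (if i = length u then delta (u @ v) w else 0)"
    if "i \<in> {..length w}" for i
  proof -
    have "delta u (take i w) * delta v (drop i w) =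
        (if take i w = u \<and> drop i w = v then 1 else 0)"
      by (simp add: delta_def)
    also have "\<dots> = (if i = length u \<and> w = u @ v then 1 else 0)"
      using split[of i] that by (simp only: atMost_iff)
    finally show ?thesis by (simp add: delta_def)
  qed
  then have "fa_mult (delta u) (delta v) w =
      (\<Sum>i\<le>length w. if i = length u then delta (u @ v) w else 0)"
    unfolding fa_mult_def by (rule sum.cong[OF refl])
  then show "fa_mult (delta u) (delta v) w = delta (u @ v) w"
    by (auto simp: delta_def)
qed

text \<open>Trilinearity reduces the claim to words, one argument at a time, and there it is
  associativity of \<open>@\<close>.\<close>

lemma fa_mult_assoc:
  assumes "finsupp f" "finsupp g" "finsupp h"
  shows "fa_mult (fa_mult f g) h = fa_mult f (fa_mult g h)"
proof -
  have 1: "fa_mult (fa_mult (delta u) (delta v)) h = fa_mult (delta u) (fa_mult (delta v) h)" for u v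
    by (rule linop_eqI[of _ _ h])
      (use assms in \<open>auto intro!: linop_compose[of "fa_mult (delta u)" "fa_mult (delta v)"]\<close>)
  have 2: "fa_mult (fa_mult (delta u) g) h = fa_mult (delta u) (fa_mult g h)" for u
    by (rule linop_eqI[of _ _ g])
      (use assms 1 in \<open>auto intro!: linop_compose[of "\<lambda>f. fa_mult f h" "fa_mult (delta u)"]
         linop_compose[of "fa_mult (delta u)" "\<lambda>f. fa_mult f h"]\<close>)
  show ?thesis
    by (rule linop_eqI[of _ _ f])
      (use assms 2 in \<open>auto intro!: linop_compose[of "\<lambda>f. fa_mult f h" "\<lambda>f. fa_mult f g"]\<close>)
qed

lemma fa_mult_one_left: "finsupp f \<Longrightarrow> fa_mult (delta []) f = f"
  by (rule linop_eqI[of _ "\<lambda>f. f"]) (auto intro: linopI)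

lemma fa_mult_one_right: "finsupp f \<Longrightarrow> fa_mult f (delta []) = f"
  by (rule linop_eqI[of "\<lambda>f. fa_mult f (delta [])" "\<lambda>f. f"]) (auto intro: linopI)

lemma ring_freealg: "ring (freealg :: ('a list \<Rightarrow> complex) ring)" (is "ring ?R")
proof (rule ringI)
  show "abelian_group ?R"
  proof (rule abelian_groupI)
    fix f :: "'a list \<Rightarrow> complex" assume "f \<in> carrier ?R"
    then show "\<exists>g\<in>carrier ?R. g \<oplus>\<^bsub>?R\<^esub> f = \<zero>\<^bsub>?R\<^esub>"
      by (intro bexI[of _ "\<lambda>w. - f w"]) auto
  qed (auto simp: add_ac)
  show "monoid ?R"
    by (rule monoidI) (auto simp: fa_mult_assoc fa_mult_one_left fa_mult_one_right)
qed (auto simp: fa_mult_add_left fa_mult_add_right)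

lemma minus_freealg [simp]:
  assumes "finsupp f" "finsupp g"
  shows "f \<ominus>\<^bsub>freealg\<^esub> g = (\<lambda>w. f w - g w)"
proof -
  interpret ring "freealg :: ('a list \<Rightarrow> complex) ring" by (rule ring_freealg)
  have "\<ominus>\<^bsub>freealg\<^esub> g = (\<lambda>w. - g w)"
    by (rule minus_equality) (use assms in auto)
  then show ?thesis by (simp add: a_minus_def)
qed

section \<open>Congruence modulo a two-sided ideal, shared by both quotient algebras\<close>

locale fa_ideal =
  fixes I :: "('g list \<Rightarrow> complex) set"
  assumes ideal: "ideal I freealg"
begin

sublocale ideal I freealg by (rule ideal)

definition eqv :: "('g list \<Rightarrow> complex) \<Rightarrow> ('g list \<Rightarrow> complex) \<Rightarrow> bool" (infix "\<approx>" 50) where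
  "f \<approx> g \<longleftrightarrow> (\<lambda>w. f w - g w) \<in> I"

lemma mem_finsupp: "f \<in> I \<Longrightarrow> finsupp f"
  using a_subset by auto

lemma mem_add: "f \<in> I \<Longrightarrow> g \<in> I \<Longrightarrow> (\<lambda>w. f w + g w) \<in> I"
  using additive_subgroup.a_closed[OF additive_subgroup_axioms, of f g] by simp

lemma mem_zero: "(\<lambda>w. 0) \<in> I"
  using additive_subgroup.zero_closed[OF additive_subgroup_axioms] by simp

text \<open>A scalar acts as left multiplication by a multiple of the empty word, so a ring ideal is
  automatically a complex subspace.\<close>

lemma mem_scale: "f \<in> I \<Longrightarrow> (\<lambda>w. s * f w) \<in> I"
  using I_l_closed[of f "\<lambda>w. s * delta [] w"]
  by (simp add: fa_mult_scale_left fa_mult_one_left mem_finsupp)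

lemma mem_sum: "finite S \<Longrightarrow> (\<And>x. x \<in> S \<Longrightarrow> V x \<in> I) \<Longrightarrow> (\<lambda>w. \<Sum>x\<in>S. c x * V x w) \<in> I"
  by (induction S rule: finite_induct) (auto simp: mem_zero mem_add mem_scale)

lemma eqv_refl [simp]: "f \<approx> f"
  by (simp add: eqv_def mem_zero)

lemma eqv_sym: "f \<approx> g \<Longrightarrow> g \<approx> f"
  using mem_scale[of "\<lambda>w. f w - g w" "-1"] by (simp add: eqv_def)

lemma eqv_trans [trans]: "f \<approx> g \<Longrightarrow> g \<approx> h \<Longrightarrow> f \<approx> h"
  using mem_add[of "\<lambda>w. f w - g w" "\<lambda>w. g w - h w"] by (simp add: eqv_def)

lemma eq_eqv_trans [trans]: "f = g \<Longrightarrow> g \<approx> h \<Longrightarrow> f \<approx> h"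
  by simp

lemma eqv_eq_trans [trans]: "f \<approx> g \<Longrightarrow> g = h \<Longrightarrow> f \<approx> h"
  by simp

lemma eqv_add: "f \<approx> g \<Longrightarrow> f' \<approx> g' \<Longrightarrow> (\<lambda>w. f w + f' w) \<approx> (\<lambda>w. g w + g' w)"
  using mem_add[of "\<lambda>w. f w - g w" "\<lambda>w. f' w - g' w"] by (simp add: eqv_def algebra_simps)

lemma eqv_scale: "f \<approx> g \<Longrightarrow> (\<lambda>w. s * f w) \<approx> (\<lambda>w. s * g w)"
  using mem_scale[of "\<lambda>w. f w - g w" s] by (simp add: eqv_def algebra_simps)

lemma eqv_diff: "f \<approx> g \<Longrightarrow> f' \<approx> g' \<Longrightarrow> (\<lambda>w. f w - f' w) \<approx> (\<lambda>w. g w - g' w)"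
  using eqv_add[OF _ eqv_scale[of f' g' "-1"], of f g] by simp

lemma eqv_mult_left: "f \<approx> g \<Longrightarrow> finsupp h \<Longrightarrow> fa_mult h f \<approx> fa_mult h g"
  using I_l_closed[of "\<lambda>w. f w - g w" h] by (simp add: eqv_def fa_mult_diff_right)

lemma eqv_mult_right: "f \<approx> g \<Longrightarrow> finsupp h \<Longrightarrow> fa_mult f h \<approx> fa_mult g h"
  using I_r_closed[of "\<lambda>w. f w - g w" h] by (simp add: eqv_def fa_mult_diff_left)

lemma eqv_zero: "f \<approx> (\<lambda>w. 0) \<longleftrightarrow> f \<in> I"
  by (simp add: eqv_def)

lemma linop_eqvI:
  assumes "linop T" "linop S" "finsupp f" "\<And>x. T (delta x) \<approx> S (delta x)"
  shows "T f \<approx> S f"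
proof -
  have "(\<lambda>w. \<Sum>x\<in>{x. f x \<noteq> 0}. f x * (T (delta x) w - S (delta x) w)) \<in> I"
    by (rule mem_sum) (use assms eqv_def finsupp_def in auto)
  then show ?thesis
    unfolding eqv_def linop_expansion[OF assms(1,3)] linop_expansion[OF assms(2,3)]
    by (simp add: linext_def sum_subtractf right_diff_distrib)
qed

lemma eqv_word: "delta u \<approx> (\<lambda>w. s * delta v w) \<Longrightarrow>
    delta (x @ u @ y) \<approx> (\<lambda>w. s * delta (x @ v @ y) w)"
  using eqv_mult_left[OF eqv_mult_right[of "delta u" "\<lambda>w. s * delta v w" "delta y"], of "delta x"]
  by (simp add: fa_mult_scale_left fa_mult_scale_right)

lemma eqv_commute_power:
  assumes "delta [x, y] \<approx> (\<lambda>w. s * delta [y, x] w)"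
  shows "delta (x # replicate n y @ v) \<approx> (\<lambda>w. s ^ n * delta (replicate n y @ x # v) w)"
proof (induction n)
  case 0
  then show ?case by simp
next
  case (Suc n)
  have "delta (x # replicate (Suc n) y @ v) \<approx> (\<lambda>w. s * delta (y # x # replicate n y @ v) w)"
    using eqv_word[OF assms, of "[]" "replicate n y @ v"] by simp
  also have "\<dots> \<approx> (\<lambda>w. s * (s ^ n * delta (replicate (Suc n) y @ x # v) w))"
    using eqv_scale[OF eqv_mult_left[OF Suc.IH, of "delta [y]"], of s]
    by (simp add: fa_mult_scale_right)
  finally show ?case by (simp add: mult.assoc)
qed

lemma coset_eq_iff:
  assumes "finsupp f" "finsupp g"
  shows "I +>\<^bsub>freealg\<^esub> f = I +>\<^bsub>freealg\<^esub> g \<longleftrightarrow> f \<approx> g"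
  using quotient_eq_iff_same_a_r_cos[OF ideal, of f g] assms by (simp add: eqv_def)

lemma coset_zero: "\<zero>\<^bsub>freealg Quot I\<^esub> = I +>\<^bsub>freealg\<^esub> (\<lambda>w. 0)"
  using a_rcos_const[OF mem_zero] by (simp add: FactRing_def)

lemma coset_mult: "finsupp f \<Longrightarrow> finsupp g \<Longrightarrow>
    (I +>\<^bsub>freealg\<^esub> f) \<otimes>\<^bsub>freealg Quot I\<^esub> (I +>\<^bsub>freealg\<^esub> g) = I +>\<^bsub>freealg\<^esub> fa_mult f g"
  using rcoset_mult_add[of f g] by (simp add: FactRing_def)

lemma coset_add: "finsupp f \<Longrightarrow> finsupp g \<Longrightarrow>
    (I +>\<^bsub>freealg\<^esub> f) \<oplus>\<^bsub>freealg Quot I\<^esub> (I +>\<^bsub>freealg\<^esub> g) = I +>\<^bsub>freealg\<^esub> (\<lambda>w. f w + g w)"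
  using a_rcos_sum[of f g] by (simp add: FactRing_def)

lemma coset_carrier: "X \<in> carrier (freealg Quot I) \<longleftrightarrow> (\<exists>f. finsupp f \<and> X = I +>\<^bsub>freealg\<^esub> f)"
  by (auto simp: FactRing_def A_RCOSETS_def')

text \<open>It serves the convolution product of \<open>Rring\<close>, whose n-th component is a
  \<open>finsum\<close> in the quotient.\<close>

lemma coset_finsum:
  assumes "\<And>i. finsupp (F i)"
  shows "finsum (freealg Quot I) (\<lambda>i. I +>\<^bsub>freealg\<^esub> F i) {..n::nat} = I +>\<^bsub>freealg\<^esub> (\<lambda>w. \<Sum>i\<le>n. F i w)"
proof -
  interpret Q: ring "freealg Quot I" by (rule quotient_is_ring)
  have carr: "I +>\<^bsub>freealg\<^esub> F i \<in> carrier (freealg Quot I)" for i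
    using assms coset_carrier by blast
  show ?thesis
  proof (induction n)
    case 0
    then show ?case using carr by simp
  next
    case (Suc n)
    have "finsupp (\<lambda>w. \<Sum>i\<le>n. F i w)" by (rule finsupp_sum) (use assms in auto)
    then show ?case
      using carr assms Suc by (simp add: coset_add add.commute)
  qed
qed

end

section \<open>The representation on normal forms\<close>

type_synonym nform = "int \<times> nat \<times> nat"

abbreviation qi :: "real \<Rightarrow> int \<Rightarrow> complex" where
  "qi q n \<equiv> complex_of_real q powi n"

text \<open>The index (i, j, k) stands for the monomial a^i c^j c*^k if i is nonnegative and
  a*^(-i) c^j c*^k otherwise; rho is left multiplication by a generator, written as a pull-back of
  coefficient functions.\<close>

definition rho :: "real \<Rightarrow> sgen \<Rightarrow> (nform \<Rightarrow> complex) \<Rightarrow> nform \<Rightarrow> complex" where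
  "rho q g v = (\<lambda>(i, j, k). case g of
      GA \<Rightarrow> v (i - 1, j, k) -
        (if i \<le> 0 \<and> 0 < j \<and> 0 < k then qi q (2 - 2 * i) * v (i - 1, j - 1, k - 1) else 0)
    | GAs \<Rightarrow> v (i + 1, j, k) -
        (if 0 \<le> i \<and> 0 < j \<and> 0 < k then qi q (- (2 * i)) * v (i + 1, j - 1, k - 1) else 0)
    | GC \<Rightarrow> if 0 < j then qi q (- i) * v (i, j - 1, k) else 0
    | GCs \<Rightarrow> if 0 < k then qi q (- i) * v (i, j, k - 1) else 0)"

definition rho_word :: "real \<Rightarrow> sgen list \<Rightarrow> (nform \<Rightarrow> complex) \<Rightarrow> nform \<Rightarrow> complex" where
  "rho_word q w = foldr (rho q) w"

definition rep :: "real \<Rightarrow> (sgen list \<Rightarrow> complex) \<Rightarrow> (nform \<Rightarrow> complex) \<Rightarrow> nform \<Rightarrow> complex" where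
  "rep q f v = linext (\<lambda>w. rho_word q w v) f"

text \<open>The vector (0, 0, 0) stands for the monomial 1, so acting on it yields the coordinates
  of f in the monomial basis.\<close>

definition nf :: "real \<Rightarrow> (sgen list \<Rightarrow> complex) \<Rightarrow> nform \<Rightarrow> complex" where
  "nf q f = rep q f (delta (0, 0, 0))"

text \<open>As \<open>nat\<close> sends negative numbers to 0, at most one of the two leading blocks
  is nonempty.\<close>

definition nword :: "nform \<Rightarrow> sgen list" where
  "nword = (\<lambda>(i, j, k). replicate (nat i) GA @ replicate (nat (- i)) GAs @
     replicate j GC @ replicate k GCs)"

definition kq :: "real \<Rightarrow> int \<Rightarrow> complex" where
  "kq q n = complex_of_real (q powr (real_of_int n / 2))"

definition kop :: "real \<Rightarrow> (nform \<Rightarrow> complex) \<Rightarrow> nform \<Rightarrow> complex" where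
  "kop q v = (\<lambda>(i, j, k). kq q (int k - i - int j) * v (i, j, k))"

text \<open>This is (1 - q^2) X_-.\<close>

definition xop :: "real \<Rightarrow> (nform \<Rightarrow> complex) \<Rightarrow> nform \<Rightarrow> complex" where
  "xop q v = (\<lambda>(i, j, k).
     qi q (int k + 1 - int j) * (1 - qi q (- 2 * (int k + 1))) * v (i - 1, j, k + 1) +
     (if i \<le> 0 \<and> 0 < j
      then qi q (int k - int j + 1) * (qi q (- 2 * int k) - qi q (2 - 2 * i)) * v (i - 1, j - 1, k)
      else 0))"

lemma rho_word_simps [simp]: "rho_word q [] v = v" "rho_word q (g # w) v = rho q g (rho_word q w v)"
  "rho_word q (u @ w) v = rho_word q u (rho_word q w v)"
  by (simp_all add: rho_word_def)

lemma linop_rho [simp]: "linop (rho q g)"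
  by (rule linopI) (auto simp: rho_def fun_eq_iff algebra_simps split: sgen.split)

text \<open>Injectivity of h where P holds makes the preimage of a finite support finite. The guard
  matters: on naturals, j - 1 is injective only for 0 < j.\<close>

lemma finsupp_pullback:
  assumes "finsupp v" "inj_on h {b. P b}"
  shows "finsupp (\<lambda>b. if P b then c b * v (h b) else 0)"
proof (rule finsuppI)
  show "finite (h -` {b. v b \<noteq> 0} \<inter> {b. P b})"
    using assms by (intro finite_vimage_IntI) (simp_all add: finsupp_def)
qed auto

lemma finsupp_rho [simp]:
  assumes "finsupp v" shows "finsupp (rho q g v)"
proof (cases g)
  case GA
  \<comment> \<open>The trivial guard and the factor 1 give the first term the shape required by
    \<open>finsupp_pullback\<close>.\<close>
  have "rho q g v = (\<lambda>b. (if True then 1 * v (case b of (i, j, k) \<Rightarrow> (i - 1, j, k)) else 0) -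
      (if (case b of (i, j, k) \<Rightarrow> i \<le> 0 \<and> 0 < j \<and> 0 < k)
       then (case b of (i, j, k) \<Rightarrow> qi q (2 - 2 * i)) *
         v (case b of (i, j, k) \<Rightarrow> (i - 1, j - 1, k - 1)) else 0))"
    by (simp add: GA rho_def fun_eq_iff)
  then show ?thesis
    by (simp only:) (intro finsupp_diff finsupp_pullback assms; auto simp: inj_on_def)
next
  case GAs
  have "rho q g v = (\<lambda>b. (if True then 1 * v (case b of (i, j, k) \<Rightarrow> (i + 1, j, k)) else 0) -
      (if (case b of (i, j, k) \<Rightarrow> 0 \<le> i \<and> 0 < j \<and> 0 < k)
       then (case b of (i, j, k) \<Rightarrow> qi q (- (2 * i))) *
         v (case b of (i, j, k) \<Rightarrow> (i + 1, j - 1, k - 1)) else 0))"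
    by (simp add: GAs rho_def fun_eq_iff)
  then show ?thesis
    by (simp only:) (intro finsupp_diff finsupp_pullback assms; auto simp: inj_on_def)
next
  case GC
  have "rho q g v = (\<lambda>b. if (case b of (i, j, k) \<Rightarrow> 0 < j)
      then (case b of (i, j, k) \<Rightarrow> qi q (- i)) * v (case b of (i, j, k) \<Rightarrow> (i, j - 1, k)) else 0)"
    by (simp add: GC rho_def fun_eq_iff)
  then show ?thesis
    by (simp only:) (intro finsupp_pullback assms; auto simp: inj_on_def)
next
  case GCs
  have "rho q g v = (\<lambda>b. if (case b of (i, j, k) \<Rightarrow> 0 < k)
      then (case b of (i, j, k) \<Rightarrow> qi q (- i)) * v (case b of (i, j, k) \<Rightarrow> (i, j, k - 1)) else 0)"
    by (simp add: GCs rho_def fun_eq_iff)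
  then show ?thesis
    by (simp only:) (intro finsupp_pullback assms; auto simp: inj_on_def)
qed

lemma finsupp_rho_word [simp]: "finsupp v \<Longrightarrow> finsupp (rho_word q w v)"
  by (induction w) auto

lemma linop_rho_word [simp]: "linop (rho_word q w)"
proof (induction w)
  case Nil
  show ?case by (rule linopI) auto
next
  case (Cons g w)
  have "linop (\<lambda>v. rho q g (rho_word q w v))"
    by (rule linop_compose) (use Cons in auto)
  then show ?case by (simp add: fun_eq_iff linop_def)
qed

lemma linop_rep [simp]: "linop (\<lambda>f. rep q f v)"
  unfolding rep_def by simp

lemma finsupp_rep [simp]: "finsupp f \<Longrightarrow> finsupp v \<Longrightarrow> finsupp (rep q f v)"
  unfolding rep_def by (rule finsupp_linext) auto

lemma rep_delta [simp]: "rep q (delta w) v = rho_word q w v"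
  by (simp add: rep_def)

lemma rep_mult:
  assumes "finsupp f" "finsupp g" "finsupp v"
  shows "rep q (fa_mult f g) v = rep q f (rep q g v)"
proof -
  have *: "rep q (fa_mult (delta u) g) v = rho_word q u (rep q g v)" for u
    by (rule linop_eqI[of _ _ g])
      (use assms in \<open>auto intro!: linop_compose[of "\<lambda>f. rep q f v" "fa_mult (delta u)"]
         linop_compose[of "rho_word q u" "\<lambda>f. rep q f v"]\<close>)
  show ?thesis
    by (rule linop_eqI[of _ _ f])
      (use assms * in \<open>auto intro!: linop_compose[of "\<lambda>f. rep q f v" "\<lambda>f. fa_mult f g"]\<close>)
qed

lemma linop_nf [simp]: "linop (nf q)"
  unfolding nf_def by simp

lemma finsupp_nf [simp]: "finsupp f \<Longrightarrow> finsupp (nf q f)"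
  unfolding nf_def by simp

lemma nf_delta_Nil: "nf q (delta []) = delta (0, 0, 0)"
  and nf_delta_Cons: "nf q (delta (g # w)) = rho q g (nf q (delta w))"
  by (simp_all add: nf_def)

lemma nf_mult_delta: "finsupp f \<Longrightarrow> nf q (fa_mult (delta [g]) f) = rho q g (nf q f)"
  by (simp add: nf_def rep_mult)

lemma finsupp_kop [simp]: "finsupp v \<Longrightarrow> finsupp (kop q v)"
  by (rule finsuppI[of "{b. v b \<noteq> 0}"]) (auto simp: kop_def finsupp_def)

lemma linop_kop [simp]: "linop (kop q)"
  by (rule linopI) (auto simp: kop_def fun_eq_iff algebra_simps)

lemma linop_xop [simp]: "linop (xop q)"
  by (rule linopI) (auto simp: xop_def fun_eq_iff algebra_simps)

lemma finsupp_xop [simp]: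
  assumes "finsupp v" shows "finsupp (xop q v)"
proof -
  have "xop q v = (\<lambda>b. (if True then (case b of (i, j, k) \<Rightarrow>
        qi q (int k + 1 - int j) * (1 - qi q (- 2 * (int k + 1)))) *
        v (case b of (i, j, k) \<Rightarrow> (i - 1, j, k + 1)) else 0) +
      (if (case b of (i, j, k) \<Rightarrow> i \<le> 0 \<and> 0 < j)
       then (case b of (i, j, k) \<Rightarrow> qi q (int k - int j + 1) * (qi q (- 2 * int k) - qi q (2 - 2 * i))) *
         v (case b of (i, j, k) \<Rightarrow> (i - 1, j - 1, k)) else 0))"
    by (auto simp: xop_def fun_eq_iff)
  then show ?thesis
    by (simp only:) (intro finsupp_add finsupp_pullback assms; auto simp: inj_on_def)
qed

section \<open>Powers of q and the operator K on normal forms\<close>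

locale quantum_parameter =
  fixes q :: real
  assumes q: "0 < q" "q < 1"
begin

lemma q_nonzero [simp]: "complex_of_real q \<noteq> 0" "q \<noteq> 0"
  using q by auto

lemma qi_add: "qi q (m + n) = qi q m * qi q n"
  by (simp add: power_int_add)

lemma qi_diff: "qi q (m - n) = qi q m / qi q n"
  by (simp add: power_int_diff)

lemma qi_minus: "qi q (- n) = inverse (qi q n)"
  by (simp add: power_int_minus)

text \<open>Together with the other rules it splits exponents such as 2 - 2 * i into copies of the
  single atom \<open>qi q i\<close>, so that identities between coefficients become rational
  identities for \<open>field_simps\<close>.\<close>

lemma qi_double: "qi q (2 * n) = qi q n * qi q n" "qi q (n * 2) = qi q n * qi q n"
  using qi_add[of n n] by (simp_all only: mult_2 mult_2_right)

lemmas qi_simps = qi_add qi_diff qi_minus qi_double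

lemma kq_add: "kq q (m + n) = kq q m * kq q n"
  and kq_diff: "kq q (m - n) = kq q m / kq q n"
  and kq_minus: "kq q (- n) = inverse (kq q n)"
  by (simp_all add: kq_def add_divide_distrib diff_divide_distrib powr_add powr_diff powr_minus)

lemma kq_nonzero [simp]: "kq q n \<noteq> 0"
  by (simp add: kq_def)

lemma kq_0 [simp]: "kq q 0 = 1"
  by (simp add: kq_def)

text \<open>Only K^2 enters the product rule of X_-, and it has integral powers of q as eigenvalues,
  which can be compared with the coefficients of \<open>rho\<close> and \<open>xop\<close>.\<close>

lemma kop_kop: "kop q (kop q v) = (\<lambda>(i, j, k). qi q (int k - i - int j) * v (i, j, k))"
proof -
  have "kq q n * kq q n = qi q n" for n
    using q by (simp add: kq_def powr_real_of_int' flip: of_real_mult powr_add of_real_power_int)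
  then show ?thesis
    by (simp add: kop_def fun_eq_iff flip: mult.assoc)
qed

lemma Kgen_simps: "Kgen q GA = inverse (kq q 1)" "Kgen q GC = inverse (kq q 1)"
  "Kgen q GAs = kq q 1" "Kgen q GCs = kq q 1"
  by (simp_all add: Kgen_def kq_def flip: powr_minus of_real_inverse)

lemma kop_rho: "kop q (rho q g v) = (\<lambda>b. Kgen q g * rho q g (kop q v) b)"
proof (rule ext, clarify)
  fix i j k
  show "kop q (rho q g v) (i, j, k) = Kgen q g * rho q g (kop q v) (i, j, k)"
    by (cases g; cases j; cases k)
      (simp_all add: Kgen_simps kop_def rho_def kq_add kq_diff kq_minus field_simps)
qed

lemma kop_zero_iff: "kop q v = (\<lambda>b. 0) \<longleftrightarrow> v = (\<lambda>b. 0)"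
  by (auto simp: kop_def fun_eq_iff)

section \<open>The defining relations hold on normal forms\<close>

lemma rho_GA_GC: "rho q GA (rho q GC v) = (\<lambda>b. q * rho q GC (rho q GA v) b)"
  by (rule ext) (auto simp: rho_def qi_simps field_simps power2_eq_square power4_eq_xxxx)

lemma rho_GA_GCs: "rho q GA (rho q GCs v) = (\<lambda>b. q * rho q GCs (rho q GA v) b)"
  by (rule ext) (auto simp: rho_def qi_simps field_simps power2_eq_square power4_eq_xxxx)

lemma rho_GCs_GAs: "rho q GCs (rho q GAs v) = (\<lambda>b. q * rho q GAs (rho q GCs v) b)"
  by (rule ext) (auto simp: rho_def qi_simps field_simps power2_eq_square power4_eq_xxxx)

lemma rho_GC_GAs: "rho q GC (rho q GAs v) = (\<lambda>b. q * rho q GAs (rho q GC v) b)"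
  by (rule ext) (auto simp: rho_def qi_simps field_simps power2_eq_square power4_eq_xxxx)

lemma rho_GC_GCs: "rho q GC (rho q GCs v) = rho q GCs (rho q GC v)"
  by (rule ext) (auto simp: rho_def)

lemma rho_GAs_GA: "rho q GAs (rho q GA v) = (\<lambda>b. v b - rho q GCs (rho q GC v) b)"
  by (rule ext) (auto simp: rho_def qi_simps field_simps power2_eq_square power4_eq_xxxx)

lemma rho_GA_GAs: "rho q GA (rho q GAs v) = (\<lambda>b. v b - q ^ 2 * rho q GC (rho q GCs v) b)"
  by (rule ext) (auto simp: rho_def qi_simps field_simps power2_eq_square power4_eq_xxxx)

text \<open>Composing \<open>xop\<close> with \<open>rho\<close> can lower j twice, each time under
  a guard 0 < j, so j = 1 is a boundary case of its own. The splits on i below have the same origin: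
  the two guards test neighbouring values of i.\<close>

lemma nat_cases3: "(j = 0 \<Longrightarrow> P) \<Longrightarrow> (j = 1 \<Longrightarrow> P) \<Longrightarrow> (\<And>m. j = Suc (Suc m) \<Longrightarrow> P) \<Longrightarrow> P"
  using not0_implies_Suc by (cases j; cases "j - 1") auto

section \<open>X_- as a twisted derivation\<close>

lemma xop_rho_GA: "xop q (rho q GA v) = rho q GA (xop q v)"
proof (rule ext, clarify)
  fix i j k
  show "xop q (rho q GA v) (i, j, k) = rho q GA (xop q v) (i, j, k)"
    by (cases j rule: nat_cases3; cases k; cases "i \<le> 0"; cases "i = 1")
      (simp_all add: xop_def rho_def qi_simps field_simps power2_eq_square power4_eq_xxxx)
qed

lemma xop_rho_GC: "xop q (rho q GC v) = rho q GC (xop q v)"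
proof (rule ext, clarify)
  fix i j k
  show "xop q (rho q GC v) (i, j, k) = rho q GC (xop q v) (i, j, k)"
    by (cases j rule: nat_cases3; cases k; cases "i \<le> 0"; cases "i = 1")
      (simp_all add: xop_def rho_def qi_simps field_simps power2_eq_square power4_eq_xxxx)
qed

text \<open>The coproduct of FK is FK \<otimes> K^2 + 1 \<otimes> FK, so X_-(g x) = X_-(g) K^2(x) +
  g X_-(x). Here X_- a* = c; for c* below the value is -q^(-1) a, while X_- kills a and c, which is
  why \<open>xop\<close> commutes with \<open>rho q GA\<close> and \<open>rho q GC\<close>.\<close>

lemma xop_rho_GAs:
  "xop q (rho q GAs v) = (\<lambda>b. (1 - q ^ 2) * rho q GC (kop q (kop q v)) b + rho q GAs (xop q v) b)"
proof (rule ext, clarify)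
  fix i j k
  show "xop q (rho q GAs v) (i, j, k) =
      (1 - q ^ 2) * rho q GC (kop q (kop q v)) (i, j, k) + rho q GAs (xop q v) (i, j, k)"
    by (cases j rule: nat_cases3; cases k; cases "i < 0"; cases "i = 0")
      (simp_all add: xop_def rho_def kop_kop qi_simps field_simps power2_eq_square power4_eq_xxxx)
qed

lemma xop_rho_GCs:
  "xop q (rho q GCs v) =
     (\<lambda>b. (1 - q ^ 2) * (- inverse q) * rho q GA (kop q (kop q v)) b + rho q GCs (xop q v) b)"
proof (rule ext, clarify)
  fix i j k
  show "xop q (rho q GCs v) (i, j, k) =
      (1 - q ^ 2) * (- inverse q) * rho q GA (kop q (kop q v)) (i, j, k) +
      rho q GCs (xop q v) (i, j, k)"
    by (cases j rule: nat_cases3; cases k; cases "i \<le> 0"; cases "i = 1")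
      (simp_all add: xop_def rho_def kop_kop qi_simps field_simps power2_eq_square power4_eq_xxxx)
qed

end

section \<open>Normal forms modulo the defining relations\<close>

lemmas rep_diff = linop_diff[OF linop_rep]
  and rep_add = linop_add[OF linop_rep]
  and rep_scale = linop_scale[OF linop_rep]

lemma rep_zero: "rep q (\<lambda>w. 0) v = (\<lambda>b. 0)"
  by (rule linop_zero[OF linop_rep])

lemma su_rels_eq: "su_rels q =
  {\<lambda>w. delta [GA, GC] w - complex_of_real q * delta [GC, GA] w,
   \<lambda>w. delta [GA, GCs] w - complex_of_real q * delta [GCs, GA] w,
   \<lambda>w. delta [GCs, GAs] w - complex_of_real q * delta [GAs, GCs] w,
   \<lambda>w. delta [GC, GAs] w - complex_of_real q * delta [GAs, GC] w,
   \<lambda>w. delta [GC, GCs] w - delta [GCs, GC] w,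
   \<lambda>w. delta [GAs, GA] w + delta [GCs, GC] w - delta [] w,
   \<lambda>w. delta [GA, GAs] w + complex_of_real q ^ 2 * delta [GC, GCs] w - delta [] w}"
  by (simp add: su_rels_def Let_def fa_gen_eq fa_scal_def)

lemma su_rels_subset: "su_rels q \<subseteq> carrier freealg"
  by (auto simp: su_rels_eq)

lemma fa_ideal_genideal: "S \<subseteq> carrier freealg \<Longrightarrow> fa_ideal (genideal freealg S)"
  by (simp add: fa_ideal_def ring.genideal_ideal ring_freealg)

text \<open>A linear lift of coordinate vectors to the free algebra. It turns normal forms back into
  representatives of cosets.\<close>

definition nf_elem :: "(nform \<Rightarrow> complex) \<Rightarrow> sgen list \<Rightarrow> complex" where
  "nf_elem v = linext (\<lambda>b. delta (nword b)) v"

lemma linop_nf_elem [simp]: "linop nf_elem"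
  using linop_linext[of "\<lambda>b. delta (nword b)"] by (simp add: linop_def nf_elem_def)

lemma nf_elem_delta [simp]: "nf_elem (delta b) = delta (nword b)"
  by (simp add: nf_elem_def)

lemma finsupp_nf_elem [simp]: "finsupp v \<Longrightarrow> finsupp (nf_elem v)"
  unfolding nf_elem_def by (rule finsupp_linext) auto

lemmas nf_elem_diff = linop_diff[OF linop_nf_elem]
  and nf_elem_scale = linop_scale[OF linop_nf_elem]
  and nf_elem_zero = linop_zero[OF linop_nf_elem]
  and nf_diff = linop_diff[OF linop_nf]
  and nf_add = linop_add[OF linop_nf]
  and nf_scale = linop_scale[OF linop_nf]
  and nf_zero = linop_zero[OF linop_nf]

context quantum_parameter
begin

sublocale su: fa_ideal "su_ideal q"
  unfolding su_ideal_def by (rule fa_ideal_genideal[OF su_rels_subset])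

abbreviation su_eqv (infix "\<simeq>q" 50) where
  "f \<simeq>q g \<equiv> su.eqv f g"

text \<open>The relations are oriented as rewriting rules towards the order a or a*, then c, then
  c*. The factor 1 in the fifth gives it the shape required by
  \<open>su.eqv_commute_power\<close>.\<close>

lemma su_relations:
  "delta [GC, GA] \<simeq>q (\<lambda>w. inverse q * delta [GA, GC] w)"
  "delta [GCs, GA] \<simeq>q (\<lambda>w. inverse q * delta [GA, GCs] w)"
  "delta [GCs, GAs] \<simeq>q (\<lambda>w. q * delta [GAs, GCs] w)"
  "delta [GC, GAs] \<simeq>q (\<lambda>w. q * delta [GAs, GC] w)"
  "delta [GCs, GC] \<simeq>q (\<lambda>w. 1 * delta [GC, GCs] w)"
  "delta [GAs, GA] \<simeq>q (\<lambda>w. delta [] w - delta [GCs, GC] w)"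
  "delta [GA, GAs] \<simeq>q (\<lambda>w. delta [] w - q ^ 2 * delta [GC, GCs] w)"
proof -
  have rel: "r \<in> su_rels q \<Longrightarrow> r \<in> su_ideal q" for r
    unfolding su_ideal_def by (rule subsetD[OF ring.genideal_self[OF ring_freealg su_rels_subset]])
  have 1: "delta [GA, GC] \<simeq>q (\<lambda>w. q * delta [GC, GA] w)"
    and 2: "delta [GA, GCs] \<simeq>q (\<lambda>w. q * delta [GCs, GA] w)"
    and 5: "delta [GC, GCs] \<simeq>q delta [GCs, GC]"
    unfolding su.eqv_def by (rule rel; simp add: su_rels_eq)+
  show "delta [GCs, GAs] \<simeq>q (\<lambda>w. q * delta [GAs, GCs] w)"
    and "delta [GC, GAs] \<simeq>q (\<lambda>w. q * delta [GAs, GC] w)"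
    unfolding su.eqv_def by (rule rel; simp add: su_rels_eq)+
  show "delta [GC, GA] \<simeq>q (\<lambda>w. inverse q * delta [GA, GC] w)"
    using su.eqv_sym[OF su.eqv_scale[OF 1, of "inverse q"]] by (simp flip: mult.assoc)
  show "delta [GCs, GA] \<simeq>q (\<lambda>w. inverse q * delta [GA, GCs] w)"
    using su.eqv_sym[OF su.eqv_scale[OF 2, of "inverse q"]] by (simp flip: mult.assoc)
  show "delta [GCs, GC] \<simeq>q (\<lambda>w. 1 * delta [GC, GCs] w)"
    using su.eqv_sym[OF 5] by simp
  have "(\<lambda>w. delta [GAs, GA] w + delta [GCs, GC] w - delta [] w) \<in> su_ideal q"
    by (rule rel) (simp add: su_rels_eq)
  then show "delta [GAs, GA] \<simeq>q (\<lambda>w. delta [] w - delta [GCs, GC] w)"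
    by (simp add: su.eqv_def algebra_simps)
  have "(\<lambda>w. delta [GA, GAs] w + complex_of_real q ^ 2 * delta [GC, GCs] w - delta [] w) \<in> su_ideal q"
    by (rule rel) (simp add: su_rels_eq)
  then show "delta [GA, GAs] \<simeq>q (\<lambda>w. delta [] w - q ^ 2 * delta [GC, GCs] w)"
    by (simp add: su.eqv_def algebra_simps)
qed

lemma rep_su_ideal:
  assumes "f \<in> su_ideal q" "finsupp v"
  shows "rep q f v = (\<lambda>b. 0)"
proof -
  \<comment> \<open>The annihilator is taken over all v: that of the single vector (0, 0, 0) would a
    priori be only a left ideal.\<close>
  let ?K = "{f. finsupp f \<and> (\<forall>v. finsupp v \<longrightarrow> rep q f v = (\<lambda>b. 0))}"
  have "ideal ?K freealg"
  proof (rule idealI)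
    show "ring (freealg :: (sgen list \<Rightarrow> complex) ring)" by (rule ring_freealg)
    show "subgroup ?K (add_monoid freealg)"
    proof (rule su.add.subgroupI)
      fix f assume f: "f \<in> ?K"
      then have "\<ominus>\<^bsub>freealg\<^esub> f = (\<lambda>w. - f w)"
        by (intro su.minus_equality) auto
      then show "\<ominus>\<^bsub>freealg\<^esub> f \<in> ?K"
        using f rep_scale[of f q "-1"] by simp
    qed (auto simp: rep_zero rep_add intro: exI[of _ "\<lambda>w. 0"])
  qed (auto simp: rep_mult linop_zero[OF linop_rep] rep_zero rep_def[of _ _ "\<lambda>b. 0"]
      linop_zero[OF linop_rho_word] linext_def)
  moreover have "su_rels q \<subseteq> ?K"
    unfolding su_rels_eq
    by (auto simp: rep_diff rep_add rep_scale rho_GA_GC rho_GA_GCs rho_GCs_GAs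
        rho_GC_GAs rho_GC_GCs rho_GAs_GA rho_GA_GAs)
  ultimately have "su_ideal q \<subseteq> ?K"
    unfolding su_ideal_def by (rule su.genideal_minimal)
  then show ?thesis using assms by auto
qed

section \<open>Normal words span the quotient\<close>

lemma rho_GC_delta: "rho q GC (delta (i, j, k)) = (\<lambda>b. qi q (- i) * delta (i, j + 1, k) b)"
  by (rule ext) (auto simp: rho_def delta_def split: if_splits)

lemma rho_GCs_delta: "rho q GCs (delta (i, j, k)) = (\<lambda>b. qi q (- i) * delta (i, j, k + 1) b)"
  by (rule ext) (auto simp: rho_def delta_def split: if_splits)

text \<open>Here i is the index of the source, whereas \<open>rho\<close> tests that of the target i
  + 1. Hence the guard \<open>i \<le> 0\<close> turns into \<open>i < 0\<close>, and the exponent 2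
  - 2 (i + 1) into -2 i.\<close>

lemma rho_GA_delta: "rho q GA (delta (i, j, k)) =
    (\<lambda>b. delta (i + 1, j, k) b -
      (if i < 0 then qi q (- (2 * i)) * delta (i + 1, j + 1, k + 1) b else 0))"
proof (rule ext, clarify)
  fix i' j' k'
  have i': "i' - 1 = i \<longleftrightarrow> i' = i + 1" by auto
  show "rho q GA (delta (i, j, k)) (i', j', k') = delta (i + 1, j, k) (i', j', k') -
      (if i < 0 then qi q (- (2 * i)) * delta (i + 1, j + 1, k + 1) (i', j', k') else 0)"
    by (cases j'; cases k'; cases "i' = i + 1") (simp_all add: rho_def delta_def i')
qed

lemma rho_GAs_delta: "rho q GAs (delta (i, j, k)) =
    (\<lambda>b. delta (i - 1, j, k) b -
      (if 0 < i then qi q (2 - 2 * i) * delta (i - 1, j + 1, k + 1) b else 0))"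
proof (rule ext, clarify)
  fix i' j' k'
  have i': "i' + 1 = i \<longleftrightarrow> i' = i - 1" by auto
  show "rho q GAs (delta (i, j, k)) (i', j', k') = delta (i - 1, j, k) (i', j', k') -
      (if 0 < i then qi q (2 - 2 * i) * delta (i - 1, j + 1, k + 1) (i', j', k') else 0)"
    by (cases j'; cases k'; cases "i' = i - 1") (simp_all add: rho_def delta_def i')
qed

text \<open>Passing i letters a costs q^(-1) each, and passing -i letters a* costs q each, so both
  signs give q^(-i).\<close>

lemma GC_nword: "delta (GC # nword (i, j, k)) \<simeq>q (\<lambda>w. qi q (- i) * delta (nword (i, j + 1, k)) w)"
proof (cases "0 \<le> i")
  case True
  then have "inverse (complex_of_real q) ^ nat i = qi q (- i)"
    by (simp add: power_int_def)
  then show ?thesis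
    using True su.eqv_commute_power[OF su_relations(1), of "nat i" "replicate j GC @ replicate k GCs"]
    by (simp add: nword_def)
next
  case False
  then have "complex_of_real q ^ nat (- i) = qi q (- i)"
    by (simp add: power_int_def)
  then show ?thesis
    using False su.eqv_commute_power[OF su_relations(4), of "nat (- i)" "replicate j GC @ replicate k GCs"]
    by (simp add: nword_def)
qed

lemma GCs_nword: "delta (GCs # nword (i, j, k)) \<simeq>q (\<lambda>w. qi q (- i) * delta (nword (i, j, k + 1)) w)"
proof -
  define p where "p = (if 0 \<le> i then replicate (nat i) GA else replicate (nat (- i)) GAs)"
  have nword: "nword (i, j, k) = p @ replicate j GC @ replicate k GCs" for k
    by (simp add: nword_def p_def)
  have "delta (GCs # nword (i, j, k)) \<simeq>q
      (\<lambda>w. qi q (- i) * delta (p @ GCs # replicate j GC @ replicate k GCs) w)"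
  proof (cases "0 \<le> i")
    case True
    then have "inverse (complex_of_real q) ^ nat i = qi q (- i)"
      by (simp add: power_int_def)
    then show ?thesis
      using True su.eqv_commute_power[OF su_relations(2), of "nat i" "replicate j GC @ replicate k GCs"]
      by (simp add: nword p_def)
  next
    case False
    then have "complex_of_real q ^ nat (- i) = qi q (- i)"
      by (simp add: power_int_def)
    then show ?thesis
      using False su.eqv_commute_power[OF su_relations(3), of "nat (- i)" "replicate j GC @ replicate k GCs"]
      by (simp add: nword p_def)
  qed
  also have "\<dots> \<simeq>q (\<lambda>w. qi q (- i) * delta (p @ replicate j GC @ GCs # replicate k GCs) w)"
    using su.eqv_mult_left[OF su.eqv_commute_power[OF su_relations(5), of j "replicate k GCs"],
        of "delta p"]
    by (intro su.eqv_scale) simp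
  finally show ?thesis by (simp add: nword)
qed

lemma GA_nword: "delta (GA # nword b) \<simeq>q nf_elem (rho q GA (delta b))"
proof -
  obtain i j k where b: "b = (i, j, k)" by (cases b)
  show ?thesis
  proof (cases "i < 0")
    case False
    then have "nword (i + 1, j, k) = GA # nword (i, j, k)"
      by (simp add: nword_def nat_add_distrib)
    then show ?thesis using False by (simp add: b rho_GA_delta)
  next
    case True
    let ?n = "nword (i + 1, j, k)"
    \<comment> \<open>The relation for a a* contributes q^2; moving first c* and then c through the
      remaining -(i + 1) letters a* contributes q^(-(i + 1)) twice.\<close>
    have coeff: "complex_of_real (q ^ 2) * qi q (- (i + 1)) * qi q (- (i + 1)) = qi q (- (2 * i))"
      by (simp add: qi_simps power2_eq_square field_simps)
    have "nat (- i) = Suc (nat (- (i + 1)))" using True by simp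
    then have "nword (i, j, k) = GAs # ?n"
      using True by (simp add: nword_def)
    then have "delta (GA # nword (i, j, k)) = fa_mult (delta [GA, GAs]) (delta ?n)"
      by simp
    also have "\<dots> \<simeq>q fa_mult (\<lambda>w. delta [] w - q ^ 2 * delta [GC, GCs] w) (delta ?n)"
      by (rule su.eqv_mult_right[OF su_relations(7)]) simp
    also have "\<dots> = (\<lambda>w. delta ?n w - q ^ 2 * fa_mult (delta [GC]) (delta (GCs # ?n)) w)"
      by (simp add: fa_mult_diff_left fa_mult_scale_left)
    also have "\<dots> \<simeq>q (\<lambda>w. delta ?n w - q ^ 2 *
        fa_mult (delta [GC]) (\<lambda>w. qi q (- (i + 1)) * delta (nword (i + 1, j, k + 1)) w) w)"
      by (intro su.eqv_diff su.eqv_refl su.eqv_scale su.eqv_mult_left GCs_nword) simp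
    also have "\<dots> = (\<lambda>w. delta ?n w - q ^ 2 *
        (qi q (- (i + 1)) * delta (GC # nword (i + 1, j, k + 1)) w))"
      by (simp add: fa_mult_scale_right)
    also have "\<dots> \<simeq>q (\<lambda>w. delta ?n w - q ^ 2 *
        (qi q (- (i + 1)) * (qi q (- (i + 1)) * delta (nword (i + 1, j + 1, k + 1)) w)))"
      by (intro su.eqv_diff su.eqv_refl su.eqv_scale GC_nword)
    also have "\<dots> = nf_elem (rho q GA (delta b))"
      using True coeff by (simp add: b rho_GA_delta nf_elem_diff nf_elem_scale flip: mult.assoc)
    finally show ?thesis by (simp add: b)
  qed
qed

lemma GAs_nword: "delta (GAs # nword b) \<simeq>q nf_elem (rho q GAs (delta b))"
proof -
  obtain i j k where b: "b = (i, j, k)" by (cases b)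
  show ?thesis
  proof (cases "0 < i")
    case False
    then have "nat (- (i - 1)) = Suc (nat (- i))" by simp
    then have "nword (i - 1, j, k) = GAs # nword (i, j, k)"
      using False by (simp add: nword_def)
    then show ?thesis using False by (simp add: b rho_GAs_delta)
  next
    case True
    let ?n = "nword (i - 1, j, k)"
    have coeff: "qi q (- (i - 1)) * qi q (- (i - 1)) = qi q (2 - 2 * i)"
      by (simp add: qi_simps power2_eq_square field_simps)
    have "nat i = Suc (nat (i - 1))" using True by simp
    then have "nword (i, j, k) = GA # ?n"
      using True by (simp add: nword_def)
    then have "delta (GAs # nword (i, j, k)) = fa_mult (delta [GAs, GA]) (delta ?n)"
      by simp
    also have "\<dots> \<simeq>q fa_mult (\<lambda>w. delta [] w - delta [GCs, GC] w) (delta ?n)"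
      by (rule su.eqv_mult_right[OF su_relations(6)]) simp
    also have "\<dots> = (\<lambda>w. delta ?n w - fa_mult (delta [GCs]) (delta (GC # ?n)) w)"
      by (simp add: fa_mult_diff_left)
    also have "\<dots> \<simeq>q (\<lambda>w. delta ?n w -
        fa_mult (delta [GCs]) (\<lambda>w. qi q (- (i - 1)) * delta (nword (i - 1, j + 1, k)) w) w)"
      by (intro su.eqv_diff su.eqv_refl su.eqv_mult_left GC_nword) simp
    also have "\<dots> = (\<lambda>w. delta ?n w -
        (qi q (- (i - 1)) * delta (GCs # nword (i - 1, j + 1, k)) w))"
      by (simp add: fa_mult_scale_right)
    also have "\<dots> \<simeq>q (\<lambda>w. delta ?n w -
        (qi q (- (i - 1)) * (qi q (- (i - 1)) * delta (nword (i - 1, j + 1, k + 1)) w)))"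
      by (intro su.eqv_diff su.eqv_refl su.eqv_scale GCs_nword)
    also have "\<dots> = nf_elem (rho q GAs (delta b))"
      using True coeff by (simp add: b rho_GAs_delta nf_elem_diff nf_elem_scale flip: mult.assoc)
    finally show ?thesis by (simp add: b)
  qed
qed

lemma generator_nf_elem:
  assumes "finsupp v"
  shows "fa_mult (delta [g]) (nf_elem v) \<simeq>q nf_elem (rho q g v)"
proof (rule su.linop_eqvI[of "\<lambda>v. fa_mult (delta [g]) (nf_elem v)" "\<lambda>v. nf_elem (rho q g v)" v])
  show "linop (\<lambda>v. fa_mult (delta [g]) (nf_elem v))"
    by (rule linop_compose[of "fa_mult (delta [g])" nf_elem]) auto
  show "linop (\<lambda>v. nf_elem (rho q g v))"
    by (rule linop_compose[of nf_elem "rho q g"]) auto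
  fix b :: nform
  obtain i j k where b: "b = (i, j, k)" by (cases b)
  show "fa_mult (delta [g]) (nf_elem (delta b)) \<simeq>q nf_elem (rho q g (delta b))"
    using GA_nword[of b] GAs_nword[of b] GC_nword[of i j k] GCs_nword[of i j k]
    by (cases g) (simp_all add: b rho_GC_delta rho_GCs_delta nf_elem_scale)
qed (rule assms)

text \<open>Spanning: a word is built up letter by letter from the right, and each new letter is
  absorbed into a combination of normal words.\<close>

lemma eqv_nf_elem:
  assumes "finsupp f"
  shows "f \<simeq>q nf_elem (nf q f)"
proof (rule su.linop_eqvI[of "\<lambda>f. f" "\<lambda>f. nf_elem (nf q f)" f])
  show "linop (\<lambda>f. nf_elem (nf q f))"
    by (rule linop_compose[of nf_elem "nf q"]) auto
  fix w :: "sgen list"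
  show "delta w \<simeq>q nf_elem (nf q (delta w))"
  proof (induction w)
    case Nil
    show ?case by (simp add: nf_delta_Nil nword_def)
  next
    case (Cons g w)
    have "delta (g # w) \<simeq>q fa_mult (delta [g]) (nf_elem (nf q (delta w)))"
      using su.eqv_mult_left[OF Cons.IH, of "delta [g]"] by simp
    also have "\<dots> \<simeq>q nf_elem (nf q (delta (g # w)))"
      unfolding nf_delta_Cons by (rule generator_nf_elem) simp
    finally show ?case .
  qed
qed (use assms in \<open>auto intro: linopI\<close>)

text \<open>One direction is that the representation kills the ideal, the other that normal words
  span the quotient. Hence \<open>nf\<close> is a faithful coordinate map on the quotient, and
  membership in the ideal is decided by coordinates.\<close>

lemma su_ideal_iff:
  assumes "finsupp f"
  shows "f \<in> su_ideal q \<longleftrightarrow> nf q f = (\<lambda>b. 0)"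
proof
  assume "f \<in> su_ideal q"
  then show "nf q f = (\<lambda>b. 0)"
    unfolding nf_def by (rule rep_su_ideal) simp
next
  assume "nf q f = (\<lambda>b. 0)"
  then show "f \<in> su_ideal q"
    using eqv_nf_elem[OF assms] by (simp add: nf_elem_zero su.eqv_zero)
qed

lemma eqv_iff: "finsupp f \<Longrightarrow> finsupp g \<Longrightarrow> f \<simeq>q g \<longleftrightarrow> nf q f = nf q g"
  by (simp add: su.eqv_def su_ideal_iff nf_diff fun_eq_iff)

end

section \<open>The actions of K and F in normal form\<close>

lemma linop_Kfa [simp]: "linop (Kfa q)"
  by (rule linopI) (auto simp: Kfa_def fun_eq_iff algebra_simps)

lemma finsupp_Kfa [simp]: "finsupp f \<Longrightarrow> finsupp (Kfa q f)"
  by (rule finsuppI[of "{w. f w \<noteq> 0}"]) (auto simp: Kfa_def finsupp_def)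

lemma Kfa_delta: "Kfa q (delta w) = (\<lambda>u. Kword q w * delta w u)"
  by (auto simp: Kfa_def delta_def)

lemma Kword_Cons: "Kword q (g # w) = Kgen q g * Kword q w"
  by (simp add: Kword_def)

lemma Ffa_eq_linext: "Ffa q = linext (Fword q)"
  by (auto simp: Ffa_def linext_def fun_eq_iff)

lemma linop_Ffa [simp]: "linop (Ffa q)"
  unfolding Ffa_eq_linext by simp

lemma Ffa_delta [simp]: "Ffa q (delta w) = Fword q w"
  by (simp add: Ffa_eq_linext)

definition Fterm :: "real \<Rightarrow> sgen list \<Rightarrow> nat \<Rightarrow> sgen list \<Rightarrow> complex" where
  "Fterm q w i = (\<lambda>u. case Fgen q (w ! i) of None \<Rightarrow> 0
     | Some (s, g') \<Rightarrow> Kinvword q (take i w) * s * Kword q (drop (Suc i) w) *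
         delta (take i w @ [g'] @ drop (Suc i) w) u)"

lemma Fword_eq_sum: "Fword q w = (\<lambda>u. \<Sum>i<length w. Fterm q w i u)"
  by (rule ext) (auto simp: Fword_def Fterm_def delta_def intro!: sum.cong split: option.splits)

lemma finsupp_Fterm [simp]: "finsupp (Fterm q w i)"
  by (cases "Fgen q (w ! i)") (auto simp: Fterm_def)

lemma finsupp_Fword [simp]: "finsupp (Fword q w)"
  unfolding Fword_eq_sum by (rule finsupp_sum) auto

lemma finsupp_Ffa [simp]: "finsupp f \<Longrightarrow> finsupp (Ffa q f)"
  unfolding Ffa_eq_linext by (rule finsupp_linext) auto

text \<open>The coproduct of F applied to the product of one letter with the rest of the word; it
  replaces the closed sum over positions by a recursion that fits induction on words.\<close>

lemma Fword_Cons: "Fword q (g # w) =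
    (\<lambda>u. (case Fgen q g of None \<Rightarrow> 0 | Some (s, g') \<Rightarrow> s * Kword q w * delta (g' # w) u) +
      inverse (Kgen q g) * fa_mult (delta [g]) (Fword q w) u)"
proof
  fix u
  have "Fterm q (g # w) (Suc i) = (\<lambda>u. inverse (Kgen q g) * fa_mult (delta [g]) (Fterm q w i) u)" for i
    by (auto simp: Fterm_def Kinvword_def fa_mult_scale_right linop_zero[OF linop_fa_mult_right] fun_eq_iff split: option.splits)
  then have "(\<Sum>i<length w. Fterm q (g # w) (Suc i) u) =
      (\<Sum>i<length w. inverse (Kgen q g) * fa_mult (delta [g]) (Fterm q w i) u)"
    by simp
  also have "\<dots> = inverse (Kgen q g) * fa_mult (delta [g]) (Fword q w) u"
    unfolding Fword_eq_sum
    using linop_sum[of "fa_mult (delta [g])" "{..<length w}" "Fterm q w" "\<lambda>_. 1"]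
    by (simp add: sum_distrib_left)
  finally have "(\<Sum>i<length w. Fterm q (g # w) (Suc i) u) =
      inverse (Kgen q g) * fa_mult (delta [g]) (Fword q w) u" .
  moreover have "Fterm q (g # w) 0 u =
      (case Fgen q g of None \<Rightarrow> 0 | Some (s, g') \<Rightarrow> s * Kword q w * delta (g' # w) u)"
    by (simp add: Fterm_def Kinvword_def split: option.split)
  ultimately show "Fword q (g # w) u =
      (case Fgen q g of None \<Rightarrow> 0 | Some (s, g') \<Rightarrow> s * Kword q w * delta (g' # w) u) +
      inverse (Kgen q g) * fa_mult (delta [g]) (Fword q w) u"
    unfolding Fword_eq_sum[of q "g # w"] length_Cons sum.lessThan_Suc_shift by simp
qed

lemma linop_fa_scal [simp]: "linop (fa_scal s)"
  by (rule linopI) (auto simp: fa_scal_def algebra_simps)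

context quantum_parameter
begin

lemma nf_Kfa:
  assumes "finsupp f" shows "nf q (Kfa q f) = kop q (nf q f)"
proof (rule linop_eqI[of "\<lambda>f. nf q (Kfa q f)" "\<lambda>f. kop q (nf q f)" f])
  show "linop (\<lambda>f. nf q (Kfa q f))" "linop (\<lambda>f. kop q (nf q f))"
    by (auto intro!: linop_compose[of "nf q" "Kfa q"] linop_compose[of "kop q" "nf q"])
  fix w
  have "kop q (nf q (delta w)) = (\<lambda>b. Kword q w * nf q (delta w) b)"
  proof (induction w)
    case Nil
    show ?case
      by (auto simp: nf_delta_Nil Kword_def kop_def fun_eq_iff delta_def[of "(0, 0, 0)"] kq_0)
  next
    case (Cons g w)
    then show ?case
      by (simp add: nf_delta_Cons kop_rho Kword_Cons linop_scale[OF linop_rho] mult.assoc)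
  qed
  then show "nf q (Kfa q (delta w)) = kop q (nf q (delta w))"
    by (simp add: Kfa_delta nf_scale)
qed (rule assms)

lemma kop_nf_delta: "kop q (nf q (delta w)) = (\<lambda>b. Kword q w * nf q (delta w) b)"
  using nf_Kfa[of "delta w"] by (simp add: Kfa_delta nf_scale)

text \<open>Since X_- is q^(-1/2) FK and \<open>xop\<close> is (1 - q^2) X_-, the factor on the
  right is q^(1/2). Treating FK rather than F alone matches the product rule behind the
  \<open>xop_rho\<close> lemmas; on a single word K is just the scalar
  \<open>Kword q w\<close>.\<close>

lemma nf_Ffa_Kfa:
  assumes "finsupp f"
  shows "(\<lambda>b. (1 - q ^ 2) * nf q (Ffa q (Kfa q f)) b) = (\<lambda>b. kq q 1 * xop q (nf q f) b)"
proof (rule linop_eqI[of "\<lambda>f b. (1 - q ^ 2) * nf q (Ffa q (Kfa q f)) b"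
      "\<lambda>f b. kq q 1 * xop q (nf q f) b" f])
  have "linop (\<lambda>f. nf q (Ffa q (Kfa q f)))"
    using linop_compose[OF linop_compose[OF linop_nf linop_Ffa] linop_Kfa, of q q q] by simp
  then show "linop (\<lambda>f b. (1 - q ^ 2) * nf q (Ffa q (Kfa q f)) b)"
    by (auto simp: linop_def algebra_simps)
  have "linop (\<lambda>f. xop q (nf q f))"
    by (auto intro!: linop_compose[of "xop q" "nf q"] simp: linop_xop)
  then show "linop (\<lambda>f b. kq q 1 * xop q (nf q f) b)"
    by (auto simp: linop_def algebra_simps)
  fix w
  let ?N = "\<lambda>w. nf q (Fword q w)"
  have "(1 - q ^ 2) * Kword q w * ?N w b = kq q 1 * xop q (nf q (delta w)) b" for b
  proof (induction w arbitrary: b)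
    case Nil
    show ?case
      by (cases b) (auto simp: Fword_eq_sum nf_zero nf_delta_Nil xop_def delta_def[of "(0, 0, 0)"])
  next
    case (Cons g w)
    have "kop q (kop q (nf q (delta w))) = (\<lambda>b. Kword q w * (Kword q w * nf q (delta w) b))"
      by (simp add: kop_nf_delta linop_scale[OF linop_kop])
    then have rho_kop: "rho q g' (kop q (kop q (nf q (delta w)))) =
        (\<lambda>b. Kword q w * (Kword q w * rho q g' (nf q (delta w)) b))" for g'
      by (simp add: linop_scale[OF linop_rho])
    \<comment> \<open>The induction hypothesis holds at every index, so it is an equation of
      functions and may be put under \<open>rho q g\<close>, which mixes indices.\<close>
    have "rho q g (\<lambda>b. (1 - q ^ 2) * Kword q w * ?N w b) = rho q g (\<lambda>b. kq q 1 * xop q (nf q (delta w)) b)"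
      using Cons.IH by presburger
    then have IH: "(1 - q ^ 2) * Kword q w * rho q g (?N w) b = kq q 1 * rho q g (xop q (nf q (delta w))) b"
      by (cases b) (simp add: linop_scale[OF linop_rho] fun_eq_iff)
    have Kgen: "Kgen q g \<noteq> 0"
      by (cases g) (simp_all add: Kgen_simps kq_nonzero)
    have N: "?N (g # w) = (\<lambda>b. (case Fgen q g of None \<Rightarrow> 0
        | Some (s, g') \<Rightarrow> s * Kword q w * rho q g' (nf q (delta w)) b) + inverse (Kgen q g) * rho q g (?N w) b)"
      by (cases "Fgen q g") (auto simp: Fword_Cons nf_scale nf_add nf_mult_delta nf_delta_Cons)
    have "(1 - q ^ 2) * Kword q (g # w) * ?N (g # w) b =
        (1 - q ^ 2) * Kgen q g * Kword q w * (case Fgen q g of None \<Rightarrow> 0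
        | Some (s, g') \<Rightarrow> s * Kword q w * rho q g' (nf q (delta w)) b) +
        (1 - q ^ 2) * Kword q w * rho q g (?N w) b"
      using Kgen by (simp add: N Kword_Cons field_simps)
    also have "\<dots> = kq q 1 * xop q (nf q (delta (g # w))) b"
      unfolding IH nf_delta_Cons
      by (cases g) (simp_all add: Fgen_def Kgen_simps xop_rho_GA xop_rho_GC
          xop_rho_GAs xop_rho_GCs rho_kop algebra_simps)
    finally show ?case .
  qed
  then show "(\<lambda>b. (1 - q ^ 2) * nf q (Ffa q (Kfa q (delta w))) b) =
      (\<lambda>b. kq q 1 * xop q (nf q (delta w)) b)"
    by (simp add: Kfa_delta nf_scale linop_scale[OF linop_Ffa] Ffa_delta mult.assoc)
qed (rule assms)

text \<open>K is invertible already on the free algebra, so f is K applied to some f'. As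
  \<open>kop\<close> is injective, f' has normal form 0 as well, and then F f = FK f' has normal
  form 0 after cancelling 1 - q^2.\<close>

lemma Ffa_su_ideal:
  assumes "f \<in> su_ideal q"
  shows "Ffa q f \<in> su_ideal q"
proof -
  have f: "finsupp f" using assms by (rule su.mem_finsupp)
  have Kword: "Kword q w \<noteq> 0" for w
  proof (induction w)
    case (Cons g w)
    then show ?case
      by (cases g) (simp_all add: Kword_Cons Kgen_simps kq_nonzero)
  qed (simp add: Kword_def)
  define f' where "f' = (\<lambda>w. inverse (Kword q w) * f w)"
  have f': "finsupp f'" "Kfa q f' = f"
    using f Kword by (auto simp: f'_def Kfa_def intro!: finsuppI[of "{w. f w \<noteq> 0}"] simp: finsupp_def)
  have "kop q (nf q f') = (\<lambda>b. 0)"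
    using nf_Kfa[OF f'(1)] su_ideal_iff[OF f] assms by (simp add: f'(2))
  then have "nf q f' = (\<lambda>b. 0)"
    using kop_zero_iff by simp
  then have "(\<lambda>b. (1 - q ^ 2) * nf q (Ffa q f) b) = (\<lambda>b. 0)"
    using nf_Ffa_Kfa[OF f'(1)] by (simp add: f'(2) linop_zero[OF linop_xop])
  moreover have "1 - complex_of_real q ^ 2 \<noteq> 0"
    using q by (simp add: power2_eq_1_iff flip: of_real_power) 
  ultimately show ?thesis
    using su_ideal_iff[OF finsupp_Ffa[OF f]] by (simp add: fun_eq_iff)
qed

lemma Kfa_su_ideal: "f \<in> su_ideal q \<Longrightarrow> Kfa q f \<in> su_ideal q"
  using su_ideal_iff[of f] su_ideal_iff[of "Kfa q f"] su.mem_finsupp[of f]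
  by (simp add: nf_Kfa linop_zero[OF linop_kop])

text \<open>The representative x chosen by \<open>SOME\<close> differs from f by an element of the
  ideal, which T does not lead out of the ideal.\<close>

lemma qlift_coset:
  assumes T: "linop T" "\<And>f. finsupp f \<Longrightarrow> finsupp (T f)" "\<And>f. f \<in> su_ideal q \<Longrightarrow> T f \<in> su_ideal q"
    and f: "finsupp f"
  shows "qlift q T (su_ideal q +>\<^bsub>freealg\<^esub> f) = su_ideal q +>\<^bsub>freealg\<^esub> T f"
proof -
  let ?P = "\<lambda>x. x \<in> carrier freealg \<and> su_ideal q +>\<^bsub>freealg\<^esub> f = su_ideal q +>\<^bsub>freealg\<^esub> x"
  define x where "x = (SOME x. ?P x)"
  have "?P x"
    unfolding x_def by (rule someI[of ?P f]) (simp add: f)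
  then have x: "finsupp x" "(\<lambda>w. f w - x w) \<in> su_ideal q"
    using su.coset_eq_iff[OF f, of x] by (simp_all add: su.eqv_def)
  then have "(\<lambda>w. T f w - T x w) \<in> su_ideal q"
    using T(3)[OF x(2)] by (simp add: linop_diff[OF T(1) f])
  then have "su_ideal q +>\<^bsub>freealg\<^esub> T f = su_ideal q +>\<^bsub>freealg\<^esub> T x"
    using su.coset_eq_iff[of "T f" "T x"] T(2) f x(1) by (simp add: su.eqv_def)
  then show ?thesis
    by (simp add: qlift_def x_def)
qed

lemma Kact_coset: "finsupp f \<Longrightarrow> Kact q (su_ideal q +>\<^bsub>freealg\<^esub> f) = su_ideal q +>\<^bsub>freealg\<^esub> Kfa q f"
  unfolding Kact_def by (rule qlift_coset) (auto intro: Kfa_su_ideal)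

lemma Fact_coset: "finsupp f \<Longrightarrow> Fact q (su_ideal q +>\<^bsub>freealg\<^esub> f) = su_ideal q +>\<^bsub>freealg\<^esub> Ffa q f"
  unfolding Fact_def by (rule qlift_coset) (auto intro: Ffa_su_ideal)

lemma Sact_coset: "finsupp f \<Longrightarrow> Sact q s (su_ideal q +>\<^bsub>freealg\<^esub> f) = su_ideal q +>\<^bsub>freealg\<^esub> fa_scal s f"
  unfolding Sact_def by (rule qlift_coset) (auto simp: fa_scal_def intro: su.mem_scale)

section \<open>Holomorphic sections in coordinates\<close>

lemma coset_zero_iff:
  assumes "finsupp f"
  shows "su_ideal q +>\<^bsub>freealg\<^esub> f = \<zero>\<^bsub>ASUq q\<^esub> \<longleftrightarrow> nf q f = (\<lambda>b. 0)"
  using assms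
  by (simp add: ASUq_def su.coset_zero su.coset_eq_iff su.eqv_zero su_ideal_iff)

text \<open>The factors q^(-1/2), 1 - q^2 and q^(1/2) relating \<open>Xminus\<close> to
  \<open>xop\<close> are nonzero, so they do not change the kernel.\<close>

lemma coset_H0_iff:
  assumes f: "finsupp f"
  shows "su_ideal q +>\<^bsub>freealg\<^esub> f \<in> H0 q n \<longleftrightarrow>
    kop q (nf q f) = (\<lambda>b. kq q n * nf q f b) \<and> xop q (nf q f) = (\<lambda>b. 0)"
proof -
  let ?c = "\<lambda>f. su_ideal q +>\<^bsub>freealg\<^esub> f"
  have "?c f \<in> carrier (ASUq q)"
    unfolding ASUq_def su.coset_carrier using f by auto
  moreover have "Kact q (?c f) = Sact q (complex_of_real (q powr (real_of_int n / 2))) (?c f) \<longleftrightarrow>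
      kop q (nf q f) = (\<lambda>b. kq q n * nf q f b)"
    using f by (simp add: Kact_coset Sact_coset su.coset_eq_iff eqv_iff nf_Kfa)
      (simp add: fa_scal_def nf_scale kq_def)
  moreover have "Xminus q (?c f) = \<zero>\<^bsub>ASUq q\<^esub> \<longleftrightarrow> xop q (nf q f) = (\<lambda>b. 0)"
  proof -
    let ?s = "complex_of_real (q powr (- 1 / 2))"
    have q2: "1 - complex_of_real q ^ 2 \<noteq> 0"
      using q by (simp add: power2_eq_1_iff flip: of_real_power)
    have "Xminus q (?c f) = ?c (fa_scal ?s (Ffa q (Kfa q f)))"
      using f by (simp add: Xminus_def Kact_coset Fact_coset Sact_coset)
    then have "Xminus q (?c f) = \<zero>\<^bsub>ASUq q\<^esub> \<longleftrightarrow> nf q (fa_scal ?s (Ffa q (Kfa q f))) = (\<lambda>b. 0)"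
      using f by (simp add: coset_zero_iff)
    also have "\<dots> \<longleftrightarrow> (\<lambda>b. (1 - q ^ 2) * nf q (Ffa q (Kfa q f)) b) = (\<lambda>b. 0)"
      using f q q2 by (simp add: fa_scal_def nf_scale fun_eq_iff)
    also have "\<dots> \<longleftrightarrow> xop q (nf q f) = (\<lambda>b. 0)"
      unfolding nf_Ffa_Kfa[OF f] by (simp add: fun_eq_iff kq_nonzero)
    finally show ?thesis .
  qed
  ultimately show ?thesis by (auto simp: H0_def LB_def)
qed

lemma H0_cases:
  assumes "X \<in> H0 q n"
  obtains f where "finsupp f" "X = su_ideal q +>\<^bsub>freealg\<^esub> f"
  using assms su.coset_carrier[of X] by (auto simp: H0_def LB_def ASUq_def)

end

section \<open>Holomorphic sections and the quantum plane\<close>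

definition emb :: "pgen \<Rightarrow> sgen" where
  "emb x = (case x of PA \<Rightarrow> GA | PC \<Rightarrow> GC)"

text \<open>The value \<open>PC\<close> on the starred letters is a placeholder:
  \<open>emb_part\<close> looks only at words in \<open>GA\<close> and \<open>GC\<close>.\<close>

definition unemb :: "sgen \<Rightarrow> pgen" where
  "unemb g = (if g = GA then PA else PC)"

text \<open>The homogeneous component of degree n of the image of p, written as a pull-back.
  Components are separated because an element of \<open>Rring\<close> is a sequence indexed by the
  degree.\<close>

definition emb_part :: "nat \<Rightarrow> (pgen list \<Rightarrow> complex) \<Rightarrow> sgen list \<Rightarrow> complex" where
  "emb_part n p = (\<lambda>w. if length w = n \<and> set w \<subseteq> {GA, GC} then p (map unemb w) else 0)"

definition emb_coset :: "real \<Rightarrow> (pgen list \<Rightarrow> complex) \<Rightarrow> nat \<Rightarrow> (sgen list \<Rightarrow> complex) set" where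
  "emb_coset q p = (\<lambda>n. su_ideal q +>\<^bsub>freealg\<^esub> emb_part n p)"

definition pword :: "nform \<Rightarrow> pgen list" where
  "pword = (\<lambda>(i, j, k). replicate (nat i) PA @ replicate j PC)"

lemma map_unemb_eq: "set w \<subseteq> {GA, GC} \<Longrightarrow> map unemb w = u \<longleftrightarrow> w = map emb u"
proof (induction w arbitrary: u)
  case (Cons g w)
  then show ?case
    by (cases u) (auto simp: emb_def unemb_def split: pgen.splits)
qed auto

lemma set_map_emb: "set (map emb u) \<subseteq> {GA, GC}"
  by (auto simp: emb_def split: pgen.splits)

lemma linop_emb_part [simp]: "linop (emb_part n)"
  by (rule linopI) (auto simp: emb_part_def)

lemma finsupp_emb_part [simp]:
  assumes "finsupp p" shows "finsupp (emb_part n p)"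
proof -
  have "inj_on (map unemb) {w. length w = n \<and> set w \<subseteq> {GA, GC}}"
    by (rule inj_onI) (metis (mono_tags) map_unemb_eq mem_Collect_eq)
  then have "finsupp (\<lambda>w. if length w = n \<and> set w \<subseteq> {GA, GC} then 1 * p (map unemb w) else 0)"
    by (rule finsupp_pullback[OF assms])
  then show ?thesis
    unfolding emb_part_def by (simp only: mult_1_left)
qed

lemma emb_part_delta:
  "emb_part n (delta u) = (if length u = n then delta (map emb u) else (\<lambda>w. 0))"
proof
  fix w
  show "emb_part n (delta u) w = (if length u = n then delta (map emb u) else (\<lambda>w. 0)) w"
    using map_unemb_eq[of w u] set_map_emb[of u] by (auto simp: emb_part_def delta_def)
qed

text \<open>For an admissible word of length n, the i-th summand sees only the cut after i letters,
  so the sum over degrees is the sum over cuts. For other words every product of values vanishes,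
  since its two pieces would together make the word admissible.\<close>

lemma emb_part_mult:
  "emb_part n (fa_mult p p') = (\<lambda>w. \<Sum>i\<le>n. fa_mult (emb_part i p) (emb_part (n - i) p') w)"
proof
  fix w :: "sgen list"
  show "emb_part n (fa_mult p p') w = (\<Sum>i\<le>n. fa_mult (emb_part i p) (emb_part (n - i) p') w)"
  proof (cases "length w = n \<and> set w \<subseteq> {GA, GC}")
    case True
    then have sub: "set (take k w) \<subseteq> {GA, GC}" "set (drop k w) \<subseteq> {GA, GC}" for k
      using set_take_subset[of k w] set_drop_subset[of k w] by auto
    have "fa_mult (emb_part i p) (emb_part (n - i) p') w =
        p (map unemb (take i w)) * p' (map unemb (drop i w))" if "i \<in> {..n}" for i
    proof -
      have "fa_mult (emb_part i p) (emb_part (n - i) p') w =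
          (\<Sum>k\<le>n. if k = i then p (map unemb (take i w)) * p' (map unemb (drop i w)) else 0)"
        unfolding fa_mult_def using True sub that by (intro sum.cong) (auto simp: emb_part_def)
      then show ?thesis using that by simp
    qed
    then show ?thesis
      using True by (simp add: emb_part_def[of n] fa_mult_def[of p] take_map drop_map)
  next
    case False
    have "emb_part i p (take k w) * emb_part (n - i) p' (drop k w) = 0" if "i \<le> n" "k \<le> length w" for i k
    proof (rule ccontr)
      assume "\<not> ?thesis"
      then have len: "length (take k w) = i" "length (drop k w) = n - i"
        and sub: "set (take k w) \<subseteq> {GA, GC}" "set (drop k w) \<subseteq> {GA, GC}"
        by (auto simp: emb_part_def split: if_splits)
      have "length w = length (take k w @ drop k w)" "set w = set (take k w @ drop k w)"
        by (simp_all only: append_take_drop_id)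
      then have "length w = n" "set w \<subseteq> {GA, GC}"
        using len sub that(1) by (simp_all only: length_append set_append Un_least le_add_diff_inverse)
      then show False using False by blast
    qed
    then have "(\<Sum>i\<le>n. fa_mult (emb_part i p) (emb_part (n - i) p') w) = 0"
      unfolding fa_mult_def by (intro sum.neutral ballI) (simp only: atMost_iff)
    moreover have "emb_part n (fa_mult p p') w = 0"
      by (simp only: emb_part_def if_not_P[OF False])
    ultimately show ?thesis by simp
  qed
qed

lemma emb_part_eq_0: "n \<notin> length ` {u. p u \<noteq> 0} \<Longrightarrow> emb_part n p = (\<lambda>w. 0)"
  by (rule ext) (auto simp: emb_part_def image_def)

section \<open>The kernel of X_- and its weight spaces\<close>

context quantum_parameter
begin

text \<open>As q is positive and not 1, it is not a root of unity; this keeps the relevant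
  coefficients of \<open>xop\<close> from vanishing.\<close>

lemma qi_eq_iff: "qi q m = qi q n \<longleftrightarrow> m = n"
proof -
  have *: "qi q m = complex_of_real (q powr real_of_int m)" for m
    using q by (simp add: powr_real_of_int')
  show ?thesis
    unfolding * of_real_eq_iff using q by (subst powr_inj) auto
qed

lemma kq_eq_iff: "kq q m = kq q n \<longleftrightarrow> m = n"
  using q by (simp add: kq_def powr_inj)

text \<open>On the span of the indices with i negative, xop v = 0 makes the support of v invariant under
  (i, j, k) \<mapsto> (i, j + 1, k + 1).\<close>

lemma xop_kernel:
  assumes "finsupp v" "xop q v = (\<lambda>b. 0)" "v (i, j, k) \<noteq> 0"
  shows "0 \<le> i \<and> k = 0"
proof -
  have eq: "xop q v (i', j', k') = 0" for i' j' k'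
    using assms(2) by simp
  show ?thesis
  proof (cases "0 \<le> i")
    case True
    have "k = 0"
    proof (cases k)
      case (Suc k')
      \<comment> \<open>At the target (i + 1, j, k') the first component is positive, so
        \<open>xop\<close> reduces to a single term there: a nonzero multiple of v (i, j,
        k).\<close>
      have "qi q (- 2 * (int k' + 1)) \<noteq> qi q 0"
        unfolding qi_eq_iff by simp
      then show ?thesis
        using eq[of "i + 1" j k'] True Suc assms(3) q by (simp add: xop_def)
    qed
    then show ?thesis using True by simp
  next
    case False
    have "v (i, j + n, k + n) \<noteq> 0" for n
    proof (induction n)
      case (Suc n)
      \<comment> \<open>At the target (i + 1, j + n + 1, k + n) the two terms of \<open>xop\<close>
        carry v (i, j + n + 1, k + n + 1) and v (i, j + n, k + n). The second coefficient is nonzero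
        because -2 (k + n) \<le> 0 < -2 i, so a nonzero second value forces a nonzero first
        one.\<close>
      have "qi q (- 2 * int (k + n)) \<noteq> qi q (2 - 2 * (i + 1))"
        unfolding qi_eq_iff using False by simp
      then show ?case
        using eq[of "i + 1" "j + n + 1" "k + n"] False Suc q by (auto simp: xop_def)
    qed (use assms in simp)
    then have "range (\<lambda>n. (i, j + n, k + n)) \<subseteq> {b. v b \<noteq> 0}" by auto
    then have "finite (range (\<lambda>n. (i, j + n, k + n)))"
      using assms(1) finite_subset unfolding finsupp_def by blast
    moreover have "inj (\<lambda>n. (i, j + n, k + n))"
      by (rule injI) simp
    ultimately show ?thesis using finite_imageD by fastforce
  qed
qed

lemma H0_support:
  assumes "finsupp f" "su_ideal q +>\<^bsub>freealg\<^esub> f \<in> H0 q (- int n)" "nf q f (i, j, k) \<noteq> 0"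
  shows "0 \<le> i \<and> k = 0 \<and> nat i + j = n"
proof -
  have 1: "kop q (nf q f) = (\<lambda>b. kq q (- int n) * nf q f b)" "xop q (nf q f) = (\<lambda>b. 0)"
    using coset_H0_iff[OF assms(1)] assms(2) by auto
  have "0 \<le> i \<and> k = 0"
    by (rule xop_kernel[OF _ 1(2) assms(3)]) (simp add: assms(1))
  moreover have "kq q (int k - i - int j) = kq q (- int n)"
    using fun_cong[OF 1(1), of "(i, j, k)"] assms(3) by (simp add: kop_def)
  ultimately show ?thesis unfolding kq_eq_iff by auto
qed

lemma nf_map_emb: "xop q (nf q (delta (map emb u))) = (\<lambda>b. 0)"
  "kop q (nf q (delta (map emb u))) = (\<lambda>b. kq q (- int (length u)) * nf q (delta (map emb u)) b)"
proof -
  show "xop q (nf q (delta (map emb u))) = (\<lambda>b. 0)"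
  proof (induction u)
    case Nil
    show ?case
      by (auto simp: nf_delta_Nil xop_def delta_def[of "(0, 0, 0)"] fun_eq_iff)
  next
    case (Cons x u)
    then show ?case
      by (cases x) (simp_all add: emb_def nf_delta_Cons xop_rho_GA xop_rho_GC
          linop_zero[OF linop_rho])
  qed
  have "Kword q (map emb u) = kq q (- int (length u))"
  proof (induction u)
    case (Cons x u)
    have "kq q (- int (length (x # u))) = kq q (- 1) * kq q (- int (length u))"
      by (simp flip: kq_add)
    then show ?case
      using Cons.IH by (cases x) (simp_all add: Kword_Cons Kgen_simps emb_def kq_minus)
  qed (simp add: Kword_def kq_0)
  then show "kop q (nf q (delta (map emb u))) =
      (\<lambda>b. kq q (- int (length u)) * nf q (delta (map emb u)) b)"
    by (simp add: kop_nf_delta)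
qed

section \<open>The ring map from the free algebra onto the ring of sections\<close>

lemma emb_coset_H0:
  assumes p: "finsupp p"
  shows "emb_coset q p n \<in> H0 q (- int n)"
proof -
  have linop1: "linop (\<lambda>p. nf q (emb_part n p))"
    by (rule linop_compose[of "nf q" "emb_part n"]) auto
  have "kop q (nf q (emb_part n p)) = (\<lambda>b. kq q (- int n) * nf q (emb_part n p) b)"
  proof (rule linop_eqI[of "\<lambda>p. kop q (nf q (emb_part n p))"
        "\<lambda>p b. kq q (- int n) * nf q (emb_part n p) b" p])
    show "linop (\<lambda>p. kop q (nf q (emb_part n p)))"
      by (rule linop_compose[of "kop q" "\<lambda>p. nf q (emb_part n p)"]) (auto simp: linop1)
    show "linop (\<lambda>p b. kq q (- int n) * nf q (emb_part n p) b)"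
      using linop1 by (auto simp: linop_def algebra_simps)
    show "kop q (nf q (emb_part n (delta u))) = (\<lambda>b. kq q (- int n) * nf q (emb_part n (delta u)) b)" for u
      using nf_map_emb(2)[of u] by (auto simp: emb_part_delta nf_zero linop_zero[OF linop_kop])
  qed (rule p)
  moreover have "xop q (nf q (emb_part n p)) = (\<lambda>b. 0)"
  proof (rule linop_eqI[of "\<lambda>p. xop q (nf q (emb_part n p))" "\<lambda>p b. 0" p])
    show "linop (\<lambda>p. xop q (nf q (emb_part n p)))"
      by (rule linop_compose[of "xop q" "\<lambda>p. nf q (emb_part n p)"]) (auto simp: linop1)
    show "linop (\<lambda>p b. 0)"
      by (rule linopI) auto
    show "xop q (nf q (emb_part n (delta u))) = (\<lambda>b. 0)" for u
      using nf_map_emb(1)[of u] by (auto simp: emb_part_delta nf_zero linop_zero[OF linop_xop])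
  qed (rule p)
  ultimately show ?thesis
    unfolding emb_coset_def using coset_H0_iff p by simp
qed

lemma emb_coset_carrier:
  assumes p: "finsupp p"
  shows "emb_coset q p \<in> carrier (Rring q)"
proof -
  have "{n. emb_coset q p n \<noteq> \<zero>\<^bsub>ASUq q\<^esub>} \<subseteq> length ` {u. p u \<noteq> 0}"
  proof
    fix n assume "n \<in> {n. emb_coset q p n \<noteq> \<zero>\<^bsub>ASUq q\<^esub>}"
    then have "nf q (emb_part n p) \<noteq> (\<lambda>b. 0)"
      using p by (simp add: emb_coset_def coset_zero_iff)
    then show "n \<in> length ` {u. p u \<noteq> 0}"
      using emb_part_eq_0[of n p] nf_zero by metis
  qed
  then have "finite {n. emb_coset q p n \<noteq> \<zero>\<^bsub>ASUq q\<^esub>}"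
    by (rule finite_subset) (use p in \<open>simp add: finsupp_def\<close>)
  then show ?thesis
    by (simp add: Rring_def Let_def emb_coset_H0[OF p])
qed

lemma emb_coset_ring_hom: "emb_coset q \<in> ring_hom freealg (Rring q)"
proof (rule ring_hom_memI)
  fix p p' :: "pgen list \<Rightarrow> complex"
  assume "p \<in> carrier freealg" "p' \<in> carrier freealg"
  then have p: "finsupp p" "finsupp p'" by simp_all
  show "emb_coset q (p \<otimes>\<^bsub>freealg\<^esub> p') = emb_coset q p \<otimes>\<^bsub>Rring q\<^esub> emb_coset q p'"
    using p by (simp add: Rring_def Let_def emb_coset_def emb_part_mult ASUq_def su.coset_mult su.coset_finsum)
  have "emb_part n (\<lambda>w. p w + p' w) = (\<lambda>w. emb_part n p w + emb_part n p' w)" for n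
    by (rule linop_add[OF linop_emb_part p])
  then show "emb_coset q (p \<oplus>\<^bsub>freealg\<^esub> p') = emb_coset q p \<oplus>\<^bsub>Rring q\<^esub> emb_coset q p'"
    using p by (simp add: Rring_def Let_def emb_coset_def ASUq_def su.coset_add)
next
  have "\<one>\<^bsub>freealg Quot su_ideal q\<^esub> = su_ideal q +>\<^bsub>freealg\<^esub> delta []"
    by (simp add: FactRing_def)
  then show "emb_coset q \<one>\<^bsub>freealg\<^esub> = \<one>\<^bsub>Rring q\<^esub>"
    by (intro ext) (simp add: Rring_def Let_def emb_coset_def emb_part_delta ASUq_def su.coset_zero)
qed (simp add: emb_coset_carrier)

lemma emb_coset_zero: "emb_coset q (\<lambda>w. 0) = \<zero>\<^bsub>Rring q\<^esub>"
  by (simp add: emb_coset_def emb_part_def Rring_def Let_def ASUq_def su.coset_zero)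

lemma emb_coset_eq_zero_iff:
  assumes "finsupp p"
  shows "emb_coset q p = \<zero>\<^bsub>Rring q\<^esub> \<longleftrightarrow> (\<forall>n. nf q (emb_part n p) = (\<lambda>b. 0))"
proof -
  have "emb_coset q p = \<zero>\<^bsub>Rring q\<^esub> \<longleftrightarrow> (\<forall>n. emb_coset q p n = \<zero>\<^bsub>ASUq q\<^esub>)"
    by (auto simp: Rring_def Let_def)
  then show ?thesis
    using assms by (simp add: emb_coset_def coset_zero_iff)
qed

lemma emb_coset_surj:
  assumes "\<Phi> \<in> carrier (Rring q)"
  obtains p where "finsupp p" "emb_coset q p = \<Phi>"
proof -
  have H0: "\<Phi> n \<in> H0 q (- int n)" and fin: "finite {n. \<Phi> n \<noteq> \<zero>\<^bsub>ASUq q\<^esub>}" for n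
    using assms by (auto simp: Rring_def Let_def)
  have "\<forall>n. \<exists>f. finsupp f \<and> \<Phi> n = su_ideal q +>\<^bsub>freealg\<^esub> f"
    using H0_cases[OF H0] by metis
  then obtain F where F: "\<And>n. finsupp (F n)" "\<And>n. \<Phi> n = su_ideal q +>\<^bsub>freealg\<^esub> F n"
    by metis
  define P where "P = linext (\<lambda>b. delta (pword b))"
  have linP: "linop P" and finP: "finsupp v \<Longrightarrow> finsupp (P v)" for v
    unfolding P_def by (auto intro: finsupp_linext)
  \<comment> \<open>All degrees are glued into one function: the coefficient of u is read off from
    the component of degree \<open>length u\<close>. Nothing is lost, because by
    \<open>H0_support\<close> the component of degree n involves only words of length n.\<close>
  define p where "p = (\<lambda>u. P (nf q (F (length u))) u)"
  have "finsupp p"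
  proof (rule finsuppI)
    let ?N = "{n. \<Phi> n \<noteq> \<zero>\<^bsub>ASUq q\<^esub>}"
    show "finite (\<Union>n\<in>?N. {u. P (nf q (F n)) u \<noteq> 0})"
      using fin finP F(1) by (auto simp flip: finsupp_def)
    have "nf q (F n) = (\<lambda>b. 0)" if "n \<notin> ?N" for n
      using that F coset_zero_iff[OF F(1)] by simp
    then have PF: "P (nf q (F n)) = (\<lambda>u. 0)" if "n \<notin> ?N" for n
      using that linop_zero[OF linP] by simp
    show "{u. p u \<noteq> 0} \<subseteq> (\<Union>n\<in>?N. {u. P (nf q (F n)) u \<noteq> 0})"
    proof
      fix u assume "u \<in> {u. p u \<noteq> 0}"
      then have u: "P (nf q (F (length u))) u \<noteq> 0"
        by (simp add: p_def)
      then have "length u \<in> ?N"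
        by (rule contrapos_np) (simp only: PF not_False_eq_True)
      then show "u \<in> (\<Union>n\<in>?N. {u. P (nf q (F n)) u \<noteq> 0})"
        using u by blast
    qed
  qed
  moreover have "emb_coset q p = \<Phi>"
  proof
    fix n
    let ?v = "nf q (F n)"
    have "emb_part n p = emb_part n (P ?v)"
      by (rule ext) (auto simp: emb_part_def p_def)
    also have "\<dots> = linext (\<lambda>b. emb_part n (P (delta b))) ?v"
      by (rule linop_expansion[of "\<lambda>v. emb_part n (P v)"])
        (use F finP linP in \<open>auto intro: linop_compose[of "emb_part n" P]\<close>)
    also have "\<dots> = nf_elem ?v"
      unfolding nf_elem_def linext_def
    proof (intro ext sum.cong refl arg_cong2[of _ _ _ _ "(*)"])
      fix b w assume "b \<in> {b. ?v b \<noteq> 0}"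
      moreover obtain i j k where b: "b = (i, j, k)" by (cases b)
      ultimately have "0 \<le> i \<and> k = 0 \<and> nat i + j = n"
        using H0_support[of "F n" n i j k] F H0[of n] by simp
      then show "emb_part n (P (delta b)) w = delta (nword b) w"
        by (simp add: P_def b pword_def emb_part_delta nword_def emb_def)
    qed
    finally have "emb_part n p = nf_elem ?v" .
    moreover have "su_ideal q +>\<^bsub>freealg\<^esub> nf_elem ?v = su_ideal q +>\<^bsub>freealg\<^esub> F n"
      using eqv_nf_elem[OF F(1)] F(1) by (simp add: su.coset_eq_iff su.eqv_sym)
    ultimately show "emb_coset q p n = \<Phi> n"
      using F(2) by (simp add: emb_coset_def)
  qed
  ultimately show thesis using that by blast
qed

section \<open>The quantum plane and its ordered monomials\<close>

abbreviation plane_rel :: "pgen list \<Rightarrow> complex" where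
  "plane_rel \<equiv> \<lambda>w. delta [PA, PC] w - complex_of_real q * delta [PC, PA] w"

abbreviation plane_ideal :: "(pgen list \<Rightarrow> complex) set" where
  "plane_ideal \<equiv> genideal freealg {plane_rel}"

lemma QPlane_eq: "QPlane q = freealg Quot plane_ideal"
  by (simp add: QPlane_def Let_def fa_gen_eq fa_scal_def)

sublocale qp: fa_ideal plane_ideal
  by (rule fa_ideal_genideal) simp

lemma plane_relation: "qp.eqv (delta [PC, PA]) (\<lambda>w. inverse q * delta [PA, PC] w)"
proof -
  have "plane_rel \<in> plane_ideal"
    by (rule subsetD[OF ring.genideal_self[OF ring_freealg]]) simp_all
  then have "qp.eqv (delta [PA, PC]) (\<lambda>w. q * delta [PC, PA] w)"
    by (simp add: qp.eqv_def)
  from qp.eqv_sym[OF qp.eqv_scale[OF this, of "inverse q"]] show ?thesis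
    using q by (simp flip: mult.assoc)
qed

text \<open>Reordering a word in a and c uses only ca = q^(-1) ac, on either side, and never creates
  further terms. The point is that the scalar \<alpha> and the exponents are the same in both
  algebras, so coordinates in the large algebra determine the class in the plane.\<close>

lemma pword_normal_form:
  "\<exists>\<alpha> i j. nf q (delta (map emb u)) = (\<lambda>b. \<alpha> * delta (int i, j, 0) b) \<and>
     qp.eqv (delta u) (\<lambda>w. \<alpha> * delta (pword (int i, j, 0)) w)"
proof (induction u)
  case Nil
  show ?case
    by (rule exI[of _ 1], rule exI[of _ 0], rule exI[of _ 0]) (simp add: nf_delta_Nil pword_def)
next
  case (Cons x u)
  then obtain \<alpha> i j where nf: "nf q (delta (map emb u)) = (\<lambda>b. \<alpha> * delta (int i, j, 0) b)"
    and eqv: "qp.eqv (delta u) (\<lambda>w. \<alpha> * delta (pword (int i, j, 0)) w)" by blast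
  have eqv': "qp.eqv (delta (x # u)) (\<lambda>w. \<alpha> * delta (x # pword (int i, j, 0)) w)"
    using qp.eqv_mult_left[OF eqv, of "delta [x]"] by (simp add: fa_mult_scale_right)
  show ?case
  proof (cases x)
    case PA
    have "nf q (delta (map emb (x # u))) = (\<lambda>b. \<alpha> * delta (int (Suc i), j, 0) b)"
      by (simp add: PA emb_def nf_delta_Cons nf linop_scale[OF linop_rho] rho_GA_delta add.commute)
    moreover have "pword (int (Suc i), j, 0) = x # pword (int i, j, 0)"
      by (simp add: pword_def PA nat_add_distrib)
    ultimately show ?thesis
      using eqv' by (intro exI[of _ \<alpha>] exI[of _ "Suc i"] exI[of _ j] conjI) (simp_all only:)
  next
    case PC
    have "nf q (delta (map emb (x # u))) = (\<lambda>b. (\<alpha> * inverse q ^ i) * delta (int i, Suc j, 0) b)"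
      by (simp add: PC emb_def nf_delta_Cons nf linop_scale[OF linop_rho] rho_GC_delta
          power_int_minus power_inverse mult.assoc)
    moreover have "qp.eqv (delta (x # pword (int i, j, 0)))
        (\<lambda>w. inverse q ^ i * delta (pword (int i, Suc j, 0)) w)"
      using qp.eqv_commute_power[OF plane_relation, of i "replicate j PC"]
      by (simp add: pword_def PC)
    then have "qp.eqv (delta (x # u)) (\<lambda>w. (\<alpha> * inverse q ^ i) * delta (pword (int i, Suc j, 0)) w)"
      using qp.eqv_trans[OF eqv' qp.eqv_scale, of "\<lambda>w. inverse q ^ i * delta (pword (int i, Suc j, 0)) w" ]
      by (simp add: mult.assoc)
    ultimately show ?thesis
      by (intro exI[of _ "\<alpha> * inverse q ^ i"] exI[of _ i] exI[of _ "Suc j"] conjI)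
  qed
qed

section \<open>The kernel and the isomorphism\<close>

lemma emb_coset_image: "emb_coset q ` carrier freealg = carrier (Rring q)"
proof
  show "carrier (Rring q) \<subseteq> emb_coset q ` carrier freealg"
  proof
    fix \<Phi> assume "\<Phi> \<in> carrier (Rring q)"
    then obtain p where "finsupp p" "emb_coset q p = \<Phi>"
      by (rule emb_coset_surj)
    then show "\<Phi> \<in> emb_coset q ` carrier freealg" by force
  qed
qed (auto simp: emb_coset_carrier)

text \<open>The ring axioms are transported rather than verified:
  \<open>ring_hom_imp_img_ring\<close> does not presuppose that the target is a ring, and the image
  is the whole carrier.\<close>

lemma ring_Rring: "ring (Rring q)"
  using ring.ring_hom_imp_img_ring[OF ring_freealg emb_coset_ring_hom]
  by (simp add: emb_coset_image emb_coset_zero)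

lemma emb_coset_ring_hom_ring: "ring_hom_ring freealg (Rring q) (emb_coset q)"
  by (rule ring_hom_ringI2[OF ring_freealg ring_Rring emb_coset_ring_hom])

text \<open>For the harder inclusion, p is recovered modulo \<open>plane_ideal\<close> from the
  normal form of its image, which is 0 for p in the kernel.\<close>

lemma emb_coset_kernel: "a_kernel freealg (Rring q) (emb_coset q) = plane_ideal"
proof
  have "nf q (emb_part n plane_rel) = (\<lambda>b. 0)" for n
  proof -
    have "emb_part n plane_rel =
        (\<lambda>w. emb_part n (delta [PA, PC]) w - q * emb_part n (delta [PC, PA]) w)"
      by (simp add: linop_diff[OF linop_emb_part] linop_scale[OF linop_emb_part])
    moreover have "nf q (\<lambda>w. delta [GA, GC] w - q * delta [GC, GA] w) = (\<lambda>b. 0)"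
      by (simp add: nf_diff nf_scale nf_delta_Cons rho_GA_GC)
    ultimately show ?thesis
      by (simp add: emb_part_delta emb_def nf_zero)
  qed
  then have "emb_coset q plane_rel = \<zero>\<^bsub>Rring q\<^esub>"
    by (simp add: emb_coset_eq_zero_iff)
  then show "plane_ideal \<subseteq> a_kernel freealg (Rring q) (emb_coset q)"
    by (intro ring.genideal_minimal[OF ring_freealg]
        ring_hom_ring.kernel_is_ideal[OF emb_coset_ring_hom_ring]) (simp add: a_kernel_def')
next
  show "a_kernel freealg (Rring q) (emb_coset q) \<subseteq> plane_ideal"
  proof
    fix p assume "p \<in> a_kernel freealg (Rring q) (emb_coset q)"
    then have p: "finsupp p" and zero: "nf q (emb_part n p) = (\<lambda>b. 0)" for n
      by (auto simp: a_kernel_def' emb_coset_eq_zero_iff)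
    define P where "P = linext (\<lambda>b. delta (pword b))"
    have linP: "linop P" by (simp add: P_def)
    \<comment> \<open>Q embeds all degrees at once; it is the sum of the components
      \<open>emb_part n\<close>, each of which has normal form 0.\<close>
    define Q where "Q = linext (\<lambda>u. delta (map emb u))"
    have linQ: "linop Q" and finQ: "finsupp f \<Longrightarrow> finsupp (Q f)" for f
      unfolding Q_def by (auto intro: finsupp_linext)
    let ?N = "length ` {u. p u \<noteq> 0}"
    have "Q p = (\<lambda>w. \<Sum>n\<in>?N. 1 * emb_part n p w)"
    proof
      fix w
      have fin: "finite ?N" using p by (simp add: finsupp_def)
      have "Q p w = (\<Sum>u\<in>{u. p u \<noteq> 0}. p u * delta (map emb u) w)"
        by (simp add: Q_def linext_def)
      also have "\<dots> = (\<Sum>u\<in>{u. p u \<noteq> 0}. \<Sum>n\<in>?N. p u * emb_part n (delta u) w)"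
      proof (rule sum.cong[OF refl])
        fix u assume "u \<in> {u. p u \<noteq> 0}"
        then have "length u \<in> ?N" by simp
        have "(\<Sum>n\<in>?N. p u * emb_part n (delta u) w) =
            (\<Sum>n\<in>?N. if length u = n then p u * delta (map emb u) w else 0)"
          by (rule sum.cong) (auto simp: emb_part_delta)
        then show "p u * delta (map emb u) w = (\<Sum>n\<in>?N. p u * emb_part n (delta u) w)"
          using fin \<open>length u \<in> ?N\<close> by (simp add: sum.delta')
      qed
      also have "\<dots> = (\<Sum>n\<in>?N. \<Sum>u\<in>{u. p u \<noteq> 0}. p u * emb_part n (delta u) w)"
        by (rule sum.swap)
      also have "\<dots> = (\<Sum>n\<in>?N. 1 * emb_part n p w)"
        using linop_expansion[OF linop_emb_part p] by (simp add: linext_def)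
      finally show "Q p w = (\<Sum>n\<in>?N. 1 * emb_part n p w)" .
    qed
    then have "nf q (Q p) = (\<lambda>b. \<Sum>n\<in>?N. 1 * nf q (emb_part n p) b)"
      using linop_sum[OF linop_nf, of ?N "\<lambda>n. emb_part n p" q "\<lambda>_. 1"] p
      by (simp add: finsupp_def[of p])
    then have nfQ: "nf q (Q p) = (\<lambda>b. 0)"
      by (simp add: zero)
    \<comment> \<open>By linearity it suffices to check words, where
      \<open>pword_normal_form\<close> provides the same scalar on both sides.\<close>
    have "qp.eqv p (P (nf q (Q p)))"
    proof (rule qp.linop_eqvI[of "\<lambda>p. p" "\<lambda>p. P (nf q (Q p))" p])
      show "linop (\<lambda>p. P (nf q (Q p)))"
        by (rule linop_compose[OF linP linop_compose[OF linop_nf linQ]]) (auto simp: finQ)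
      show "qp.eqv (delta u) (P (nf q (Q (delta u))))" for u
      proof -
        obtain \<alpha> i j where "nf q (delta (map emb u)) = (\<lambda>b. \<alpha> * delta (int i, j, 0) b)"
          and "qp.eqv (delta u) (\<lambda>w. \<alpha> * delta (pword (int i, j, 0)) w)"
          using pword_normal_form[of u] by blast
        then show ?thesis
          by (simp add: Q_def linop_scale[OF linP] P_def linop_scale[OF linop_linext])
      qed
    qed (use p in \<open>auto intro: linopI\<close>)
    then show "p \<in> plane_ideal"
      by (simp add: nfQ linop_zero[OF linP] qp.eqv_zero)
  qed
qed

end

theorem theorem4p5:
  fixes q :: real
  assumes "0 < q" and "q < 1"
  shows "ring (Rring q) \<and> Rring q \<simeq> QPlane q"
proof
  interpret quantum_parameter q
    by unfold_locales (use assms in auto)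
  show "ring (Rring q)"
    by (rule ring_Rring)
  have "freealg Quot a_kernel freealg (Rring q) (emb_coset q) \<simeq> Rring q"
    by (rule ring_hom_ring.FactRing_iso[OF emb_coset_ring_hom_ring emb_coset_image])
  then have "QPlane q \<simeq> Rring q"
    by (simp add: QPlane_eq emb_coset_kernel)
  moreover have "ring (QPlane q)"
    unfolding QPlane_eq
    by (intro ideal.quotient_is_ring ring.genideal_ideal[OF ring_freealg]) simp
  ultimately show "Rring q \<simeq> QPlane q"
    by (rule ring_iso_sym[rotated])
qed

end
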